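(* Let $a,\delta\in(0,1)$. For a polytope $P\subset\mathbb{R}^n$ write $V(P)$ for its set of vertices and $\mathcal{F}(P)$ for its set of facets ($(n-1)$-dimensional faces), and let $B_2^n$ be the Euclidean unit ball. 1. If $a\in\mathbb{Q}$, there exist a sequence of $n$-dimensional polytopes $P_n\subset\mathbb{R}^n$ and radii $0<r_n\le R_n$ with $r_nB_2^n\subset P_n\subset R_nB_2^n$ such that \[ \log|\mathcal{F}(P_n)| = O(n^{1-a}),\qquad \log|V(P_n)| = O\big(n^{a+\delta(1-a)}\big),\qquad \Big(\frac{R_n}{r_n}\Big)^2 = O\big(n^{1-\delta+a}\big), \] so that \[ \log|V(P_n)|\cdot\log|\mathcal{F}(P_n)|\cdot\Big(\frac{R_n}{r_n}\Big)^2 = O\big(n^{2+a(1-\delta)}\big). \] 2. If $a\notin\mathbb{Q}$, there exist a sequence of $n$-dimensional polytopes $P_n\subset\mathbb{R}^n$ and radii $0<r_n\le R_n$ with $r_nB_2^n\subset P_n\subset R_nB_2^n$ such that \[ \log|\mathcal{F}(P_n)| = O(n^{1-a}),\qquad \log|V(P_n)| = O\big(n^{a+\delta(1-a)+\varepsilon_n}\big),\qquad \Big(\frac{R_n}{r_n}\Big)^2 = O\big(n^{1-\delta+a}\big), \] so that \[ \log|V(P_n)|\cdot\log|\mathcal{F}(P_n)|\cdot\Big(\frac{R_n}{r_n}\Big)^2 = O\big(n^{2+a(1-\delta)+\varepsilon_n}\big), \] where $\varepsilon_n\to 0$; concretely one may take $\varepsilon_n = O\big(1/\sqrt{\log n}\big)$.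 In both parts, all implied constants in the $O$-notation depend only on $a$ and $\delta$.
   Context: $O(\cdot)$ denotes an upper bound up to a multiplicative constant, here allowed to depend on $a$ and $\delta$ only. *)

theory Defs
  imports "HOL-Analysis.Analysis" "HOL-Analysis.Finite_Function_Topology"
begin

text \<open>
  The dimension varies along the sequence, so all the spaces \<open>\<real>\<^sup>n\<close> are realised inside one
  real vector space: \<open>\<real>\<^sup>n\<close> is the space of finitely supported real sequences supported in
  \<open>{0, \<dots>, n - 1}\<close>. Only the vector space structure of the type is used (\<open>polytope\<close>,
  \<open>face_of\<close>, \<open>extreme_point_of\<close>); its norm instance is the \<open>\<ell>\<^sub>1\<close> norm, hence the
  explicit Euclidean norm in \<open>B2\<close>.
\<close>

definition Rn :: "nat \<Rightarrow> (nat \<Rightarrow>\<^sub>0 real) set" where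
  "Rn n = {x. Poly_Mapping.keys x \<subseteq> {..<n}}"

definition B2 :: "nat \<Rightarrow> (nat \<Rightarrow>\<^sub>0 real) set" where
  "B2 n = {x \<in> Rn n. L2_set (Poly_Mapping.lookup x) {..<n} \<le> 1}"

text \<open>
  The library's \<open>aff_dim\<close> and \<open>facet_of\<close> require a Euclidean space. These are the same
  definitions for real vector spaces, except that \<open>B\<close> must be finite, since \<open>card\<close> is zero
  on infinite sets; on infinite-dimensional sets \<open>affdim\<close> is unspecified.
\<close>

definition affdim :: "'a::real_vector set \<Rightarrow> int" where
  "affdim V = (SOME d::int. \<exists>B. finite B \<and> affine hull B = affine hull V \<and>
      \<not> affine_dependent B \<and> int (card B) = d + 1)"

definition vertices :: "'a::real_vector set \<Rightarrow> 'a set" where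
  "vertices P = {x. x extreme_point_of P}"

definition facets :: "'a::real_vector set \<Rightarrow> 'a set set" where
  "facets P = {F. F face_of P \<and> F \<noteq> {} \<and> affdim F = affdim P - 1}"

lemma affine_basis_card_le:
  fixes B C :: "'a::real_vector set"
  assumes "finite B" "finite C" "\<not> affine_dependent B" "\<not> affine_dependent C"
    and eq: "affine hull B = affine hull C"
  shows "card B \<le> card C"
proof (cases "B = {}")
  case False
  then have "C \<noteq> {}" using eq by auto
  then obtain c where c: "c \<in> C" by blast
  obtain b where b: "b \<in> B" using False by blast
  let ?T = "\<lambda>S x. (\<lambda>y. - x + y) ` (S - {x})"
  have indB: "independent (?T B b)"
    using affine_dependent_iff_dependent[of b "B - {b}"] assms(3) b by (simp add: insert_absorb)
  have hB: "affine hull B = (\<lambda>y. b + y) ` span (?T B b)"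
    using affine_hull_insert_span_gen[of b "B - {b}"] b by (simp add: insert_absorb)
  have hC: "affine hull C = (\<lambda>y. c + y) ` span (?T C c)"
    using affine_hull_insert_span_gen[of c "C - {c}"] c by (simp add: insert_absorb)
  have "b \<in> affine hull C" using hull_inc[OF b, of affine] by (simp add: eq)
  then have bc: "b - c \<in> span (?T C c)" unfolding hC by (metis add_diff_cancel_left' imageE)
  have "?T B b \<subseteq> span (?T C c)"
  proof
    fix z assume "z \<in> ?T B b"
    then have "b + z \<in> B" by auto
    then have "b + z \<in> affine hull C" using hull_inc[of "b + z" B affine] by (simp add: eq)
    then have "b + z - c \<in> span (?T C c)" unfolding hC by (metis add_diff_cancel_left' imageE)
    from span_diff[OF this bc] show "z \<in> span (?T C c)" by simp
  qed
  then have "card (?T B b) \<le> card (?T C c)"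
    using independent_span_bound[of "?T C c" "?T B b"] indB assms(2) by simp
  moreover have "card (?T B b) = card B - 1" "card (?T C c) = card C - 1"
    using b c by (simp_all add: card_image card_Diff_singleton)
  moreover have "card B > 0" "card C > 0" using assms b c by (auto simp: card_gt_0_iff)
  ultimately show ?thesis by linarith
qed simp

lemma affdim_eqI:
  fixes V :: "'a::real_vector set"
  assumes "finite B" "affine hull B = affine hull V" "\<not> affine_dependent B"
  shows "affdim V = int (card B) - 1"
  unfolding affdim_def
proof (rule some_equality)
  show "\<exists>C. finite C \<and> affine hull C = affine hull V \<and> \<not> affine_dependent C \<and>
      int (card C) = int (card B) - 1 + 1"
    using assms by auto
next
  fix d
  assume "\<exists>C. finite C \<and> affine hull C = affine hull V \<and> \<not> affine_dependent C \<and>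
      int (card C) = d + 1"
  then obtain C where C: "finite C" "affine hull C = affine hull V" "\<not> affine_dependent C"
    "int (card C) = d + 1" by blast
  have "card B = card C"
    by (intro antisym affine_basis_card_le) (use assms C in simp_all)
  then show "d = int (card B) - 1" using C by simp
qed

lemma affdim_eq_aff_dim: "affdim V = aff_dim V" for V :: "'a::euclidean_space set"
proof -
  obtain B where "affine hull B = affine hull V" "\<not> affine_dependent B"
    "int (card B) = aff_dim V + 1"
    using aff_dim_basis_exists[of V] by blast
  with affdim_eqI[OF aff_independent_finite] show ?thesis by fastforce
qed

lemma facets_eq_facet_of: "facets P = {F. F facet_of P}" for P :: "'a::euclidean_space set"
  by (simp add: facets_def facet_of_def affdim_eq_aff_dim)

end

theory Submission
  imports Defs
begin

text \<open>
  In \<open>\<real>\<^sup>k\<close> let \<open>E\<close> be the convex hull of the normalised sign vectors \<open>s / \<bar>s\<bar>\<close>,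
  \<open>s \<in> {-1, 0, 1}\<^sup>k\<close>. Its gauge is the Lorentz norm \<open>\<Sum> w\<^sub>j x\<^sup>*\<^sub>j\<close> of the decreasing
  rearrangement \<open>x\<^sup>*\<close> of \<open>\<bar>x\<bar>\<close> with weights \<open>w\<^sub>j = sqrt (j + 1) - sqrt j\<close>, so that \<open>E\<close> is cut out by
  the signed permutations of \<open>w\<close>. Hence \<open>E\<close> has at most \<open>3\<^sup>k\<close> vertices and \<open>(2 k)\<^sup>k\<close> facets, lies in
  the unit ball, and contains the ball of radius \<open>1 / \<bar>w\<bar>\<close>, where \<open>\<bar>w\<bar>\<^sup>2 \<le> 1 + ln k\<close>.
  The \<open>\<ell>\<^sub>\<infinity>\<close>-sum of \<open>A\<close> copies of the \<open>\<ell>\<^sub>1\<close>-sum of \<open>B\<close> copies of \<open>E\<close> has at most \<open>(B 3\<^sup>k)\<^sup>A\<close> vertices,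
  at most \<open>A (2 k)\<^bsup>B k\<^esup>\<close> facets, and \<open>(R / r)\<^sup>2 \<le> A B (1 + ln k)\<close>. Up to an arbitrarily small
  power of \<open>n\<close> one takes \<open>k\<close>, \<open>B\<close>, \<open>A\<close> to be \<open>n\<close> to the powers \<open>\<delta> (1 - a)\<close>, \<open>(1 - \<delta>) (1 - a)\<close>, \<open>a\<close>. This
  works for every \<open>a\<close>, rational or not, with \<open>\<epsilon>\<^sub>n = 0\<close>.
\<close>


section \<open>Polytopes as convex hulls and as intersections of half-spaces\<close>

lemma lookup_scaleR: "Poly_Mapping.lookup (c *\<^sub>R x) i = c * Poly_Mapping.lookup x i"
  for x :: "'a \<Rightarrow>\<^sub>0 real"
proof -
  have "finite {i. c * Poly_Mapping.lookup x i \<noteq> 0}"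
    by (rule finite_subset[of _ "Poly_Mapping.keys x"]) (auto simp: in_keys_iff)
  then show ?thesis
    by (simp add: scaleR_poly_mapping_def)
qed

lemma mem_Rn_iff: "x \<in> Rn n \<longleftrightarrow> (\<forall>i\<ge>n. Poly_Mapping.lookup x i = 0)"
  by (auto simp: Rn_def in_keys_iff subset_iff) (meson not_le)

lemma subspace_Rn: "subspace (Rn n)"
  by (auto simp: subspace_def mem_Rn_iff lookup_add lookup_scaleR)

lemma Rn_eqI:
  assumes "x \<in> Rn n" "y \<in> Rn n" "\<And>i. i < n \<Longrightarrow> Poly_Mapping.lookup x i = Poly_Mapping.lookup y i"
  shows "x = y"
  using assms by (intro poly_mapping_eqI) (metis mem_Rn_iff not_le)

definition unit_vec :: "nat \<Rightarrow> (nat \<Rightarrow>\<^sub>0 real)" where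
  "unit_vec i = Poly_Mapping.single i 1"

lemma lookup_unit_vec: "Poly_Mapping.lookup (unit_vec i) j = (if i = j then 1 else 0)"
  by (simp add: unit_vec_def lookup_single when_def)

lemma unit_vec_in_Rn: "i < n \<Longrightarrow> unit_vec i \<in> Rn n"
  by (simp add: mem_Rn_iff lookup_unit_vec)

lemma inj_unit_vec: "inj unit_vec"
  by (metis injI lookup_unit_vec zero_neq_one)

lemma lookup_sum_unit_vec:
  "Poly_Mapping.lookup (\<Sum>i<n. u i *\<^sub>R unit_vec i) j = (if j < n then u j else 0)"
  by (simp add: lookup_sum lookup_scaleR lookup_unit_vec if_distrib[of "(*) _"] cong: if_cong)

lemma span_unit_vec: "span (unit_vec ` {..<n}) = Rn n"
proof
  show "span (unit_vec ` {..<n}) \<subseteq> Rn n"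
    by (intro span_minimal subspace_Rn) (auto simp: unit_vec_in_Rn)
  show "Rn n \<subseteq> span (unit_vec ` {..<n})"
  proof
    fix x assume x: "x \<in> Rn n"
    have "x = (\<Sum>i<n. Poly_Mapping.lookup x i *\<^sub>R unit_vec i)"
      using x by (intro poly_mapping_eqI) (auto simp: lookup_sum_unit_vec mem_Rn_iff)
    moreover have "(\<Sum>i<n. Poly_Mapping.lookup x i *\<^sub>R unit_vec i) \<in> span (unit_vec ` {..<n})"
      by (intro span_sum span_scale span_base) auto
    ultimately show "x \<in> span (unit_vec ` {..<n})" by simp
  qed
qed

lemma independent_unit_vec: "independent (unit_vec ` {..<n})"
proof -
  have "u i = 0" if "(\<Sum>v\<in>unit_vec ` {..<n}. u v *\<^sub>R v) = 0" "i \<in> unit_vec ` {..<n}" for u i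
  proof -
    from that(2) obtain j where j: "i = unit_vec j" "j < n" by blast
    have "(\<Sum>v\<in>unit_vec ` {..<n}. u v *\<^sub>R v) = (\<Sum>i<n. u (unit_vec i) *\<^sub>R unit_vec i)"
      by (subst sum.reindex) (auto intro: inj_on_subset[OF inj_unit_vec])
    then have "Poly_Mapping.lookup (\<Sum>i<n. u (unit_vec i) *\<^sub>R unit_vec i) j = 0"
      using that by simp
    then show ?thesis using j by (simp add: lookup_sum_unit_vec)
  qed
  then show ?thesis
    by (auto simp: dependent_finite)
qed

lemma card_independent_Rn:
  assumes "independent B" "B \<subseteq> Rn n"
  shows "finite B \<and> card B \<le> n"
  using independent_span_bound[of "unit_vec ` {..<n}" B] assms
  by (simp add: span_unit_vec card_image inj_on_subset[OF inj_unit_vec])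

section \<open>Linear functionals and Euclidean balls\<close>

definition pairing :: "nat \<Rightarrow> (nat \<Rightarrow> real) \<Rightarrow> (nat \<Rightarrow>\<^sub>0 real) \<Rightarrow> real" where
  "pairing n h x = (\<Sum>i<n. h i * Poly_Mapping.lookup x i)"

lemma linear_pairing: "linear (pairing n h)"
  by (rule linearI)
    (simp_all add: pairing_def lookup_add lookup_scaleR sum.distrib sum_distrib_left algebra_simps)

lemma pairing_simps:
  "pairing n h (x + y) = pairing n h x + pairing n h y"
  "pairing n h (x - y) = pairing n h x - pairing n h y"
  "pairing n h (c *\<^sub>R x) = c * pairing n h x"
  "pairing n h 0 = 0"
  "pairing n h (\<Sum>i\<in>I. f i) = (\<Sum>i\<in>I. pairing n h (f i))"
  using linear_pairing[of n h]
  by (simp_all add: linear_add linear_diff linear_scale linear_0 linear_sum)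

lemma pairing_le_L2_set:
  "pairing n h x \<le> L2_set h {..<n} * L2_set (Poly_Mapping.lookup x) {..<n}"
proof -
  have "pairing n h x \<le> (\<Sum>i<n. \<bar>h i\<bar> * \<bar>Poly_Mapping.lookup x i\<bar>)"
    unfolding pairing_def by (intro sum_mono) (metis abs_ge_self abs_mult)
  also have "\<dots> \<le> L2_set h {..<n} * L2_set (Poly_Mapping.lookup x) {..<n}"
    by (rule L2_set_mult_ineq)
  finally show ?thesis .
qed

lemma L2_set_scaleR:
  "L2_set (Poly_Mapping.lookup (c *\<^sub>R x)) I = \<bar>c\<bar> * L2_set (Poly_Mapping.lookup x) I"
  for x :: "'a \<Rightarrow>\<^sub>0 real"
proof -
  have "L2_set (Poly_Mapping.lookup (c *\<^sub>R x)) I = L2_set (\<lambda>i. \<bar>c\<bar> * Poly_Mapping.lookup x i) I"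
    unfolding L2_set_def by (simp add: lookup_scaleR power_mult_distrib)
  then show ?thesis by (simp add: L2_set_right_distrib)
qed

lemma scaled_B2_eq:
  assumes "R > 0"
  shows "(*\<^sub>R) R ` B2 n = {x \<in> Rn n. L2_set (Poly_Mapping.lookup x) {..<n} \<le> R}"
proof (intro equalityI subsetI)
  fix x assume "x \<in> (*\<^sub>R) R ` B2 n"
  then show "x \<in> {x \<in> Rn n. L2_set (Poly_Mapping.lookup x) {..<n} \<le> R}"
    using assms by (auto simp: B2_def L2_set_scaleR subspace_scale[OF subspace_Rn])
next
  fix x assume x: "x \<in> {x \<in> Rn n. L2_set (Poly_Mapping.lookup x) {..<n} \<le> R}"
  have "x = R *\<^sub>R (inverse R *\<^sub>R x)" using assms by simp
  moreover have "inverse R *\<^sub>R x \<in> B2 n"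
    using x assms by (auto simp: B2_def L2_set_scaleR subspace_scale[OF subspace_Rn] field_simps)
  ultimately show "x \<in> (*\<^sub>R) R ` B2 n" by blast
qed

lemma convex_scaled_B2:
  assumes "R > 0"
  shows "convex ((*\<^sub>R) R ` B2 n)"
proof -
  have "L2_set (Poly_Mapping.lookup (u *\<^sub>R x + v *\<^sub>R y)) {..<n} \<le> R"
    if "L2_set (Poly_Mapping.lookup x) {..<n} \<le> R" "L2_set (Poly_Mapping.lookup y) {..<n} \<le> R"
      and uv: "0 \<le> u" "0 \<le> v" "u + v = 1" for x y :: "nat \<Rightarrow>\<^sub>0 real" and u v
  proof -
    have "L2_set (Poly_Mapping.lookup (u *\<^sub>R x + v *\<^sub>R y)) {..<n}
        \<le> L2_set (Poly_Mapping.lookup (u *\<^sub>R x)) {..<n} + L2_set (Poly_Mapping.lookup (v *\<^sub>R y)) {..<n}"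
      using L2_set_triangle_ineq[of "Poly_Mapping.lookup (u *\<^sub>R x)" "Poly_Mapping.lookup (v *\<^sub>R y)"]
      unfolding lookup_add[abs_def] .
    also have "\<dots> \<le> u * R + v * R"
      using that by (auto simp: L2_set_scaleR intro!: add_mono mult_left_mono)
    also have "\<dots> = R" using uv by (simp flip: distrib_right)
    finally show ?thesis .
  qed
  then show ?thesis
    unfolding scaled_B2_eq[OF assms] convex_def
    by (auto intro!: subspace_add[OF subspace_Rn] subspace_scale[OF subspace_Rn])
qed

section \<open>Faces and facets of polyhedra\<close>

lemma face_of_imp_eq_affine_Int_real_vector:
  fixes S :: "'a::real_vector set"
  assumes "T face_of S"
  shows "T = affine hull T \<inter> S"
proof
  have T: "convex T" "T \<subseteq> S" using assms by (auto simp: face_of_def)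
  then show "T \<subseteq> affine hull T \<inter> S" by (simp add: hull_subset)
  show "affine hull T \<inter> S \<subseteq> T"
  proof
    fix y assume y: "y \<in> affine hull T \<inter> S"
    then obtain Q u where Q: "finite Q" "Q \<subseteq> T" "sum u Q = 1" "(\<Sum>v\<in>Q. u v *\<^sub>R v) = y"
      by (auto simp: affine_hull_explicit)
    \<comment> \<open>Sorting the affine coefficients of \<open>y\<close> by sign gives
      \<open>y + t *\<^sub>R q = (1 + t) *\<^sub>R p\<close> with \<open>p\<close>, \<open>q\<close>
      in \<open>T\<close>. So \<open>p\<close> lies strictly between \<open>y\<close> and
      \<open>q\<close> unless \<open>y = q\<close> or \<open>t = 0\<close>, and the face property
      then puts \<open>y\<close> into \<open>T\<close>.\<close>
    define Qp where "Qp = {v \<in> Q. u v > 0}"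
    define Qn where "Qn = {v \<in> Q. u v \<le> 0}"
    have QQ: "Q = Qp \<union> Qn" "Qp \<inter> Qn = {}" "finite Qp" "finite Qn"
      using Q by (auto simp: Qp_def Qn_def)
    define t where "t = - sum u Qn"
    have t: "t \<ge> 0" unfolding t_def by (auto simp: Qn_def intro!: sum_nonpos)
    have sp: "sum u Qp = 1 + t"
      using Q QQ unfolding t_def by (simp add: sum.union_disjoint)
    have ysplit: "y = (\<Sum>v\<in>Qp. u v *\<^sub>R v) + (\<Sum>v\<in>Qn. u v *\<^sub>R v)"
      using Q QQ by (simp add: sum.union_disjoint)
    define p where "p = (\<Sum>v\<in>Qp. (u v / (1 + t)) *\<^sub>R v)"
    have pT: "p \<in> T" unfolding p_def
      by (rule convex_sum[OF QQ(3) T(1)])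
        (use sp t Q in \<open>auto simp: Qp_def simp flip: sum_divide_distrib\<close>)
    have psum: "(\<Sum>v\<in>Qp. u v *\<^sub>R v) = (1 + t) *\<^sub>R p"
      using t by (simp add: p_def scaleR_sum_right)
    show "y \<in> T"
    proof (cases "t = 0")
      case True
      then have "\<forall>v\<in>Qn. u v = 0"
        using sum_nonneg_eq_0_iff[OF QQ(4), of "\<lambda>v. - u v"]
        by (auto simp: t_def Qn_def sum_negf)
      then show ?thesis using ysplit psum True pT by simp
    next
      case False
      then have t: "t > 0" using t by simp
      define q where "q = (\<Sum>v\<in>Qn. (- u v / t) *\<^sub>R v)"
      have "(\<Sum>v\<in>Qn. - u v / t) = 1"
        using t unfolding t_def by (simp add: sum_negf flip: sum_divide_distrib)
      then have qT: "q \<in> T" unfolding q_def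
        by (intro convex_sum[OF QQ(4) T(1)]) (use t Q in \<open>auto simp: Qn_def field_simps\<close>)
      have qsum: "(\<Sum>v\<in>Qn. u v *\<^sub>R v) = - (t *\<^sub>R q)"
        using t by (simp add: q_def scaleR_sum_right sum_negf)
      have yq: "y + t *\<^sub>R q = (1 + t) *\<^sub>R p" using ysplit psum qsum by simp
      have "p = inverse (1 + t) *\<^sub>R (y + t *\<^sub>R q)" using yq t by simp
      moreover have "1 - t / (1 + t) = inverse (1 + t)" using t by (simp add: field_simps)
      ultimately have pe: "p = (1 - t / (1 + t)) *\<^sub>R y + (t / (1 + t)) *\<^sub>R q"
        by (simp add: scaleR_add_right divide_inverse mult.commute)
      show ?thesis
      proof (cases "y = q")
        case False
        then have "p \<in> open_segment y q"
          using pe t by (auto simp: in_segment intro!: exI[of _ "t / (1 + t)"])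
        then show ?thesis using face_ofD[OF assms, of p y q] y qT pT T by auto
      qed (use qT in simp)
    qed
  qed
qed

text \<open>Otherwise every functional is below 1 somewhere on \<open>F\<close>, and the average
  \<open>c\<close> of such points makes all of them strict at once. Any segment from a point
  \<open>y\<close> of \<open>P\<close> to \<open>c\<close> can then be prolonged a little inside
  \<open>P\<close>, so the face property at \<open>c\<close> forces \<open>F = P\<close>.\<close>

lemma face_of_polyhedron_subset_hyperplane:
  assumes H: "finite H" and Hne: "H \<noteq> {}"
    and P: "P = {x \<in> Rn n. \<forall>h\<in>H. pairing n h x \<le> 1}"
    and F: "F face_of P" "F \<noteq> {}" "F \<noteq> P"
  shows "\<exists>h\<in>H. \<forall>x\<in>F. pairing n h x = 1"
proof (rule ccontr)
  have FP: "F \<subseteq> P" "convex F" using F by (auto simp: face_of_def)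
  assume "\<not> ?thesis"
  moreover have le1: "pairing n h x \<le> 1" if "h \<in> H" "x \<in> P" for h x
    using that by (simp add: P)
  ultimately have "\<forall>h\<in>H. \<exists>x\<in>F. pairing n h x < 1"
    using FP(1) by (meson less_le subsetD)
  then obtain z where z: "\<And>h. h \<in> H \<Longrightarrow> z h \<in> F \<and> pairing n h (z h) < 1" by metis
  define c where "c = (\<Sum>h\<in>H. (1 / card H) *\<^sub>R z h)"
  have cF: "c \<in> F" unfolding c_def
    by (rule convex_sum[OF H FP(2)]) (use H Hne z in auto)
  have zP: "pairing n h (z h') \<le> 1" if "h \<in> H" "h' \<in> H" for h h'
    using that z FP(1) le1 by blast
  have c1: "pairing n h c < 1" if "h \<in> H" for h
  proof -
    have "pairing n h c = (\<Sum>h'\<in>H. (1 / card H) * pairing n h (z h'))"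
      by (simp add: c_def pairing_simps)
    also have "\<dots> < (\<Sum>h'\<in>H. 1 / card H)"
    proof (rule sum_strict_mono_ex1[OF H])
      have pos: "0 < real (card H)" using H Hne by (simp add: card_gt_0_iff)
      show "\<forall>x\<in>H. 1 / real (card H) * pairing n h (z x) \<le> 1 / real (card H)"
        using pos zP[OF that] by (auto simp: field_simps)
      show "\<exists>a\<in>H. 1 / real (card H) * pairing n h (z a) < 1 / real (card H)"
        using pos z[OF that] that by (auto simp: field_simps)
    qed
    also have "\<dots> = 1" using H Hne by simp
    finally show ?thesis .
  qed
  have "P \<subseteq> F"
  proof
    fix y assume y: "y \<in> P"
    \<comment> \<open>The added 1 keeps the denominators positive; \<open>e\<close> is the largest
      step allowed by all the quotients at once.\<close>
    define b where "b h = \<bar>pairing n h c - pairing n h y\<bar> + 1" for h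
    define e where "e = Min ((\<lambda>h. (1 - pairing n h c) / b h) ` H)"
    have e: "e > 0" unfolding e_def using H Hne c1
      by (subst Min_gr_iff) (auto simp: b_def intro!: divide_pos_pos)
    define w where "w = c + e *\<^sub>R (c - y)"
    have "pairing n h w \<le> 1" if "h \<in> H" for h
    proof -
      have "e \<le> (1 - pairing n h c) / b h" unfolding e_def using H that by auto
      then have "e * b h \<le> 1 - pairing n h c" by (simp add: b_def field_simps)
      moreover have "e * (pairing n h c - pairing n h y) \<le> e * b h"
        using e by (intro mult_left_mono) (auto simp: b_def)
      ultimately show ?thesis by (simp add: w_def pairing_simps)
    qed
    moreover have "c \<in> Rn n" "y \<in> Rn n" using cF y FP(1) by (auto simp: P)
    then have "w \<in> Rn n" unfolding w_def
      by (intro subspace_add subspace_diff subspace_scale subspace_Rn)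
    ultimately have "w \<in> P" by (simp add: P)
    moreover have "c \<in> open_segment y w" if "y \<noteq> c"
    proof -
      have "w - y = (1 + e) *\<^sub>R (c - y)" by (simp add: w_def algebra_simps)
      then have "c = y + (1 / (1 + e)) *\<^sub>R (w - y)" using e by simp
      then have "c = (1 - 1 / (1 + e)) *\<^sub>R y + (1 / (1 + e)) *\<^sub>R w" by (simp add: algebra_simps)
      moreover have "y \<noteq> w" using that e \<open>w - y = _\<close> by auto
      ultimately show ?thesis using e by (auto simp: in_segment intro!: exI[of _ "1 / (1 + e)"])
    qed
    ultimately show "y \<in> F" using face_ofD[OF F(1), of c y w] cF y by auto
  qed
  then show False using F FP by auto
qed

text \<open>A facet lies in some hyperplane \<open>pairing n h x = 1\<close> and contains
  \<open>n\<close> affinely independent points. These form a basis of \<open>Rn n\<close>, so every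
  point of the slice is a combination of them; evaluating \<open>h\<close> shows that its
  coefficients sum to 1. The slice thus lies in the affine hull of \<open>F\<close>, hence in
  \<open>F\<close>. Facets can therefore be counted by functionals.\<close>

lemma facet_eq_hyperplane_slice:
  assumes H: "finite H" and Hne: "H \<noteq> {}"
    and P: "P = {x \<in> Rn n. \<forall>h\<in>H. pairing n h x \<le> 1}"
    and dim: "affdim P = int n" and F: "F \<in> facets P"
  shows "\<exists>h\<in>H. F = {x \<in> P. pairing n h x = 1}"
proof -
  have F': "F face_of P" "F \<noteq> {}" "affdim F = int n - 1" "F \<noteq> P"
    using F dim by (auto simp: facets_def)
  obtain h where h: "h \<in> H" "\<And>x. x \<in> F \<Longrightarrow> pairing n h x = 1"
    using face_of_polyhedron_subset_hyperplane[OF H Hne P F'(1,2,4)] by blast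
  have FP: "F \<subseteq> P" using F' by (simp add: face_of_imp_subset)
  obtain B where B: "B \<subseteq> F" "\<not> affine_dependent B" "affine hull F = affine hull B"
    using affine_basis_exists by blast
  have hB: "pairing n h b = 1" if "b \<in> B" for b using h B that by auto
  \<comment> \<open>\<open>B\<close> lies in a hyperplane avoiding the origin, so affine independence is linear independence\<close>
  have indB: "independent B"
  proof
    assume "dependent B"
    then obtain T u v where T: "finite T" "T \<subseteq> B" "v \<in> T" "u v \<noteq> 0" "(\<Sum>v\<in>T. u v *\<^sub>R v) = 0"
      by (auto simp: dependent_explicit)
    have "(\<Sum>v\<in>T. u v) = (\<Sum>v\<in>T. u v * pairing n h v)"
      using T hB by (intro sum.cong) auto
    also have "\<dots> = pairing n h (\<Sum>v\<in>T. u v *\<^sub>R v)" by (simp add: pairing_simps)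
    also have "\<dots> = 0" by (simp add: T pairing_simps)
    finally have "affine_dependent B"
      using T by (auto simp: affine_dependent_explicit)
    then show False using B by simp
  qed
  have BR: "B \<subseteq> Rn n" using B FP P by auto
  have finB: "finite B" using card_independent_Rn[OF indB BR] by simp
  have cardB: "card B = n" using affdim_eqI[OF finB B(3)[symmetric] B(2)] F' by simp
  have "F = {x \<in> P. pairing n h x = 1}"
  proof
    show "{x \<in> P. pairing n h x = 1} \<subseteq> F"
    proof safe
      fix z assume z: "z \<in> P" "pairing n h z = 1"
      have "z \<in> span B"
      proof (rule ccontr)
        assume nz: "z \<notin> span B"
        then have "independent (insert z B)" using indB by (simp add: independent_insertI)
        then have "card (insert z B) \<le> n"
          using card_independent_Rn[of "insert z B" n] BR z P by auto
        moreover have "z \<notin> B" using nz span_base by blast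
        ultimately show False using finB cardB by simp
      qed
      then obtain u where u: "z = (\<Sum>b\<in>B. u b *\<^sub>R b)"
        by (auto simp: span_finite[OF finB])
      have "sum u B = (\<Sum>b\<in>B. u b * pairing n h b)"
        using hB by (intro sum.cong) auto
      also have "\<dots> = 1" using z(2) by (simp add: u pairing_simps)
      finally have "z \<in> affine hull B" using u by (auto simp: affine_hull_finite[OF finB])
      then show "z \<in> F"
        using face_of_imp_eq_affine_Int_real_vector[OF F'(1)] z B by auto
    qed
  qed (use h FP in auto)
  then show ?thesis using h by blast
qed

text \<open>The ball supplies 0 and multiples of all unit vectors, so the affine hull of
  \<open>P\<close> is \<open>Rn n\<close>, with affine basis 0 and the unit vectors.\<close>

lemma affdim_eq_if_ball_subset:
  assumes "0 < r" "(*\<^sub>R) r ` B2 n \<subseteq> P" "P \<subseteq> Rn n"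
  shows "affdim P = int n"
proof -
  let ?E = "unit_vec ` {..<n}"
  have ball: "r *\<^sub>R x \<in> P" if "x \<in> B2 n" for x using that assms by auto
  have "0 \<in> B2 n" by (simp add: B2_def mem_Rn_iff L2_set_def)
  from ball[OF this] have 0: "0 \<in> P" by simp
  have "unit_vec i \<in> B2 n" if "i < n" for i
    using that by (simp add: B2_def unit_vec_in_Rn L2_set_def lookup_unit_vec
        if_distrib[of "\<lambda>x. x ^ 2"] cong: if_cong)
  then have *: "r *\<^sub>R unit_vec i \<in> P" if "i < n" for i using ball that by auto
  have "unit_vec i \<in> span P" if "i < n" for i
  proof -
    have "inverse r *\<^sub>R (r *\<^sub>R unit_vec i) \<in> span P" using * that by (intro span_scale span_base)
    then show ?thesis using assms by simp
  qed
  then have "span ?E \<subseteq> span P" by (intro span_minimal) auto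
  moreover have "span P \<subseteq> Rn n" using assms(3) by (intro span_minimal subspace_Rn)
  ultimately have spP: "span P = Rn n" by (simp add: span_unit_vec)
  have aP: "affine hull P = Rn n" using affine_hull_span_0[OF hull_inc[OF 0]] spP by simp
  have 0: "0 \<notin> ?E"
  proof
    assume "0 \<in> ?E"
    then have "dependent ?E" by (rule dependent_zero)
    with independent_unit_vec show False by contradiction
  qed
  have "affine hull (insert 0 ?E) = span (insert 0 ?E)"
    by (rule affine_hull_span_0[OF hull_inc[OF insertI1]])
  then have aE: "affine hull (insert 0 ?E) = Rn n" by (simp add: span_insert_0 span_unit_vec)
  have "\<not> affine_dependent (insert 0 ?E)"
    unfolding affine_dependent_iff_dependent[OF 0] using independent_unit_vec[of n]
    by (simp add: image_image)
  then have "affdim P = int (card (insert 0 ?E)) - 1"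
    by (intro affdim_eqI) (auto simp: aE aP)
  also have "\<dots> = int n"
    using 0 by (simp add: card_image inj_on_subset[OF inj_unit_vec])
  finally show ?thesis .
qed

text \<open>Reads all required data off a double description. Cauchy-Schwarz on \<open>H\<close>
  gives the inner ball and convexity of balls the outer one. Each facet is a slice by some element
  of \<open>H\<close> and each vertex is an element of \<open>S\<close>; since only upper bounds on
  the counts are claimed, both sets may contain redundant elements.\<close>

lemma polytope_with_polar_description:
  assumes S: "finite S" and H: "finite H" "H \<noteq> {}"
    and hull: "convex hull S = {x \<in> Rn n. \<forall>h\<in>H. pairing n h x \<le> 1}"
    and r: "0 < r" "\<And>h. h \<in> H \<Longrightarrow> r * L2_set h {..<n} \<le> 1"
    and R: "0 < R" "\<And>s. s \<in> S \<Longrightarrow> L2_set (Poly_Mapping.lookup s) {..<n} \<le> R"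
  defines "P \<equiv> convex hull S"
  shows "polytope P" "P \<subseteq> Rn n" "affdim P = int n" "(*\<^sub>R) r ` B2 n \<subseteq> P" "P \<subseteq> (*\<^sub>R) R ` B2 n"
    "card (facets P) \<le> card H" "card (vertices P) \<le> card S"
proof -
  show "polytope P" unfolding polytope_def P_def using S by blast
  show PR: "P \<subseteq> Rn n" by (auto simp: P_def hull)
  show ball: "(*\<^sub>R) r ` B2 n \<subseteq> P"
  proof safe
    fix x assume x: "x \<in> B2 n"
    have "pairing n h (r *\<^sub>R x) \<le> 1" if "h \<in> H" for h
    proof -
      have "pairing n h (r *\<^sub>R x) \<le> r * (L2_set h {..<n} * L2_set (Poly_Mapping.lookup x) {..<n})"
        using r by (simp add: pairing_simps pairing_le_L2_set)
      also have "\<dots> \<le> r * (L2_set h {..<n} * 1)"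
        using x r by (intro mult_left_mono) (auto simp: B2_def)
      also have "\<dots> \<le> 1" using r(2)[OF that] by simp
      finally show ?thesis .
    qed
    then show "r *\<^sub>R x \<in> P"
      using x by (auto simp: P_def hull B2_def subspace_scale[OF subspace_Rn])
  qed
  show dim: "affdim P = int n" by (rule affdim_eq_if_ball_subset[OF r(1) ball PR])
  show "P \<subseteq> (*\<^sub>R) R ` B2 n"
    unfolding P_def
  proof (rule hull_minimal)
    show "S \<subseteq> (*\<^sub>R) R ` B2 n"
      using hull_subset[of S convex] R(2) PR by (auto simp: scaled_B2_eq[OF R(1)] P_def)
  qed (rule convex_scaled_B2[OF R(1)])
  have "facets P \<subseteq> (\<lambda>h. {x \<in> P. pairing n h x = 1}) ` H"
    using facet_eq_hyperplane_slice[OF H, of P n] dim hull unfolding P_def by blast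
  then show "card (facets P) \<le> card H"
    using H(1) by (meson card_image_le card_mono finite_imageI order_trans)
  have "vertices P \<subseteq> S" by (auto simp: vertices_def P_def dest: extreme_point_of_convex_hull)
  then show "card (vertices P) \<le> card S" using S by (simp add: card_mono)
qed

section \<open>The sign vector polytope\<close>

text \<open>The Lorentz weights. They telescope: the first \<open>m\<close> of them sum to
  \<open>sqrt m\<close>, so a normalised sign vector with \<open>m > 0\<close> nonzero entries has
  gauge exactly 1.\<close>

definition sqrt_step :: "nat \<Rightarrow> real" where
  "sqrt_step j = sqrt (real (Suc j)) - sqrt (real j)"

lemma sqrt_step_altdef: "sqrt_step j = 1 / (sqrt (real (Suc j)) + sqrt (real j))"
proof -
  have "sqrt_step j * (sqrt (real (Suc j)) + sqrt (real j)) = 1"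
    by (simp add: sqrt_step_def algebra_simps)
  moreover have "sqrt (real (Suc j)) + sqrt (real j) > 0"
    by (intro add_pos_nonneg) auto
  ultimately show ?thesis by (simp add: field_simps)
qed

lemma sqrt_step_nonneg: "sqrt_step j \<ge> 0"
  by (simp add: sqrt_step_def)

lemma sqrt_step_antimono: "i \<le> j \<Longrightarrow> sqrt_step j \<le> sqrt_step i"
  unfolding sqrt_step_altdef
  by (intro divide_left_mono mult_pos_pos add_mono add_pos_nonneg) auto

text \<open>The weights decrease, so an initial segment is the worst case. In the induction the new
  maximum \<open>b\<close> is at least \<open>card A\<close>, and its weight is at most the next
  telescoping increment.\<close>

lemma sum_sqrt_step_le:
  assumes "finite A"
  shows "(\<Sum>j\<in>A. sqrt_step j) \<le> sqrt (real (card A))"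
  using assms
proof (induction A rule: finite_linorder_max_induct)
  case (insert b A)
  have "A \<subseteq> {..<b}" using insert by auto
  then have "card A \<le> b" using card_mono[of "{..<b}" A] by simp
  then have "sqrt_step b \<le> sqrt_step (card A)" by (rule sqrt_step_antimono)
  moreover have "b \<notin> A" using insert by auto
  ultimately show ?case using insert by (simp add: sqrt_step_def)
qed simp

lemma sqrt_step_square_le: "(sqrt_step j)\<^sup>2 \<le> 1 / real (Suc j)"
proof -
  have "sqrt_step j \<le> 1 / sqrt (real (Suc j))"
    unfolding sqrt_step_altdef
    by (intro divide_left_mono mult_pos_pos add_pos_nonneg) auto
  then have "(sqrt_step j)\<^sup>2 \<le> (1 / sqrt (real (Suc j)))\<^sup>2"
    by (intro power_mono sqrt_step_nonneg)
  then show ?thesis by (simp add: power_divide)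
qed

text \<open>The squared weights are dominated by the harmonic series, which is compared with the
  logarithm term by term.\<close>

lemma sum_sqrt_step_square_le:
  assumes "k \<ge> 1"
  shows "(\<Sum>j<k. (sqrt_step j)\<^sup>2) \<le> 1 + ln (real k)"
  using assms
proof (induction k rule: dec_induct)
  case base
  then show ?case by (simp add: sqrt_step_def)
next
  case (step k)
  have "ln (real k / real (Suc k)) \<le> real k / real (Suc k) - 1"
    using step by (intro ln_le_minus_one) auto
  also have "\<dots> = - (1 / real (Suc k))" by (simp add: field_simps)
  finally have "1 / real (Suc k) \<le> ln (real (Suc k)) - ln (real k)"
    using step by (simp add: ln_div)
  then show ?case using step sqrt_step_square_le[of k] by simp
qed

text \<open>Elements are inserted in order of decreasing value, so a new one receives the last rank;
  ties are broken by the order of insertion. The induction rule may also reinsert an old element, in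
  which case nothing changes.\<close>

lemma exists_ranking:
  fixes x :: "'a \<Rightarrow> real"
  assumes "finite I"
  shows "\<exists>\<rho>. bij_betw \<rho> I {..<card I} \<and> (\<forall>i\<in>I. \<forall>j\<in>I. \<rho> i \<le> \<rho> j \<longrightarrow> x j \<le> x i)"
  using assms
proof (induction I rule: finite_ranking_induct[where f = "\<lambda>i. - x i"])
  case empty
  then show ?case by (auto simp: bij_betw_def)
next
  case (insert a I)
  show ?case
  proof (cases "a \<in> I")
    case False
    obtain \<rho> where \<rho>: "bij_betw \<rho> I {..<card I}" "\<forall>i\<in>I. \<forall>j\<in>I. \<rho> i \<le> \<rho> j \<longrightarrow> x j \<le> x i"
      using insert by blast
    have lt: "\<rho> i < card I" if "i \<in> I" for i using \<rho>(1) that by (auto simp: bij_betw_def)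
    let ?\<rho> = "\<rho>(a := card I)"
    have "bij_betw ?\<rho> I {..<card I}"
      using \<rho>(1) False by (subst bij_betw_cong[of I _ \<rho>]) auto
    then have "bij_betw ?\<rho> (insert a I) (insert (card I) {..<card I})"
      using False notIn_Un_bij_betw[of a I ?\<rho> "{..<card I}"] by simp
    then have "bij_betw ?\<rho> (insert a I) {..<card (insert a I)}"
      using False insert(1) by (simp add: lessThan_Suc)
    moreover have "\<forall>i\<in>insert a I. \<forall>j\<in>insert a I. ?\<rho> i \<le> ?\<rho> j \<longrightarrow> x j \<le> x i"
      using \<rho>(2) insert(2) False lt by (auto simp: not_le dest: leD)
    ultimately show ?thesis by blast
  qed (use insert in \<open>simp add: insert_absorb\<close>)
qed

text \<open>Summation by parts; the boundary term vanishes once \<open>y m = 0\<close>.\<close>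

lemma abel_sum_sqrt_step:
  "(\<Sum>j<m. (y j - y (Suc j)) * sqrt (real (Suc j))) = (\<Sum>j<m. y j * sqrt_step j) - y m * sqrt (real m)"
  by (induction m) (simp_all add: sqrt_step_def algebra_simps)

text \<open>
  If \<open>\<rho>\<close> ranks the coordinates by decreasing \<open>\<bar>x i\<bar>\<close>, then \<open>x\<close> is the sum over \<open>j\<close> of
  \<open>y j - y (j + 1)\<close> times the sign vector on the \<open>j + 1\<close> largest coordinates, where \<open>y j\<close> is the
  \<open>j\<close>-th largest absolute value.
\<close>

lemma layer_cake:
  fixes x \<sigma> :: "'a \<Rightarrow> real"
  assumes I: "finite I" and \<sigma>: "\<And>i. i \<in> I \<Longrightarrow> x i = \<sigma> i * \<bar>x i\<bar>"
  shows "\<exists>\<rho> c. bij_betw \<rho> I {..<card I} \<and> (\<forall>j. c j \<ge> 0) \<and>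
    (\<forall>i\<in>I. x i = (\<Sum>j<card I. c j * (if \<rho> i \<le> j then \<sigma> i / sqrt (real (Suc j)) else 0))) \<and>
    (\<Sum>j<card I. c j) = (\<Sum>i\<in>I. \<bar>x i\<bar> * sqrt_step (\<rho> i))"
proof -
  obtain \<rho> where \<rho>: "bij_betw \<rho> I {..<card I}"
    and mono: "\<And>i j. i \<in> I \<Longrightarrow> j \<in> I \<Longrightarrow> \<rho> i \<le> \<rho> j \<Longrightarrow> \<bar>x j\<bar> \<le> \<bar>x i\<bar>"
    using exists_ranking[OF I, of "\<lambda>i. \<bar>x i\<bar>"] by blast
  define m where "m = card I"
  \<comment> \<open>The default 0 from index \<open>m\<close> on makes the telescoping sums end
    without a boundary term.\<close>
  define y where "y j = (if j < m then \<bar>x (inv_into I \<rho> j)\<bar> else 0)" for j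
  \<comment> \<open>The factor \<open>sqrt (real (Suc j))\<close> undoes the normalisation of the
    layer with \<open>j + 1\<close> nonzero entries.\<close>
  define c where "c j = (y j - y (Suc j)) * sqrt (real (Suc j))" for j
  have \<rho>lt: "\<rho> i < m" if "i \<in> I" for i using \<rho> that by (auto simp: bij_betw_def m_def)
  have y\<rho>: "y (\<rho> i) = \<bar>x i\<bar>" if "i \<in> I" for i
    using \<rho> that \<rho>lt by (simp add: y_def bij_betw_def)
  have ym: "y m = 0" by (simp add: y_def)
  have "y (Suc j) \<le> y j" for j
  proof (cases "Suc j < m")
    case True
    then obtain i i' where "i \<in> I" "i' \<in> I" "\<rho> i = j" "\<rho> i' = Suc j"
      using \<rho> unfolding bij_betw_def m_def by (metis Suc_lessD imageE lessThan_iff)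
    then show ?thesis using mono[of i i'] y\<rho>[of i] y\<rho>[of i'] by simp
  qed (simp add: y_def)
  then have c0: "\<forall>j. c j \<ge> 0" by (simp add: c_def)
  have "x i = (\<Sum>j<m. c j * (if \<rho> i \<le> j then \<sigma> i / sqrt (real (Suc j)) else 0))" if i: "i \<in> I" for i
  proof -
    have "(\<Sum>j<m. c j * (if \<rho> i \<le> j then \<sigma> i / sqrt (real (Suc j)) else 0))
        = (\<Sum>j\<in>{\<rho> i..<m}. \<sigma> i * (y j - y (Suc j)))"
      by (rule sum.mono_neutral_cong_right) (auto simp: c_def)
    also have "\<dots> = \<sigma> i * (y (\<rho> i) - y m)"
      using \<rho>lt[OF i] sum_Suc_diff'[of "\<rho> i" m "\<lambda>j. - y j"]
      by (simp flip: sum_distrib_left)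
    finally show ?thesis using \<sigma>[OF i] by (simp add: y\<rho>[OF i] ym)
  qed
  moreover have "(\<Sum>j<m. c j) = (\<Sum>i\<in>I. \<bar>x i\<bar> * sqrt_step (\<rho> i))"
  proof -
    have "(\<Sum>j<m. c j) = (\<Sum>j<m. y j * sqrt_step j)"
      unfolding c_def abel_sum_sqrt_step ym by simp
    also have "\<dots> = (\<Sum>i\<in>I. y (\<rho> i) * sqrt_step (\<rho> i))"
      by (rule sum.reindex_bij_betw[OF \<rho>[folded m_def], symmetric])
    finally show ?thesis by (simp add: y\<rho>)
  qed
  ultimately show ?thesis using \<rho> c0 unfolding m_def by blast
qed

text \<open>The weight missing from 1 is given to the point 0.\<close>

lemma convex_sum_le_1:
  fixes C :: "'a::real_vector set"
  assumes C: "convex C" "0 \<in> C" and I: "finite I"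
    and a: "\<And>i. i \<in> I \<Longrightarrow> a i \<ge> 0" "(\<Sum>i\<in>I. a i) \<le> 1" and y: "\<And>i. i \<in> I \<Longrightarrow> y i \<in> C"
  shows "(\<Sum>i\<in>I. a i *\<^sub>R y i) \<in> C"
proof (cases "(\<Sum>i\<in>I. a i) = 0")
  case True
  then have "\<forall>i\<in>I. a i = 0" using sum_nonneg_eq_0_iff[OF I, of a] a by simp
  then show ?thesis using C by simp
next
  case False
  define t where "t = (\<Sum>i\<in>I. a i)"
  have t: "0 < t" "t \<le> 1"
    using False a sum_nonneg[of I a] by (auto simp: t_def)
  have "(\<Sum>i\<in>I. (a i / t) *\<^sub>R y i) \<in> C"
    using t a by (intro convex_sum[OF I C(1)] y) (auto simp: t_def simp flip: sum_divide_distrib)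
  then have "t *\<^sub>R (\<Sum>i\<in>I. (a i / t) *\<^sub>R y i) + (1 - t) *\<^sub>R 0 \<in> C"
    using t C by (intro convexD) auto
  then show ?thesis using t by (simp add: scaleR_sum_right)
qed

lemma card_functions_with_support:
  fixes V :: "'b::zero set"
  assumes "finite I" "finite V"
  defines "X \<equiv> {h. (\<forall>i\<in>I. h i \<in> V) \<and> (\<forall>i. i \<notin> I \<longrightarrow> h i = 0)}"
  shows "finite X" "card X \<le> card V ^ card I"
proof -
  have sub: "X \<subseteq> (\<lambda>f i. if i \<in> I then f i else 0) ` (PiE I (\<lambda>_. V))"
  proof
    fix h assume h: "h \<in> X"
    then have "h = (\<lambda>i. if i \<in> I then restrict h I i else 0)" by (auto simp: X_def)
    moreover have "restrict h I \<in> PiE I (\<lambda>_. V)" using h by (auto simp: X_def)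
    ultimately show "h \<in> (\<lambda>f i. if i \<in> I then f i else 0) ` (PiE I (\<lambda>_. V))" by (rule image_eqI)
  qed
  have fin: "finite (PiE I (\<lambda>_. V))" using assms by (intro finite_PiE)
  show "finite X" using sub fin finite_subset by blast
  have "card X \<le> card (PiE I (\<lambda>_. V))"
    using sub fin by (meson card_image_le card_mono finite_imageI order_trans)
  then show "card X \<le> card V ^ card I" using assms by (simp add: card_PiE)
qed

definition coord_vec :: "nat \<Rightarrow> (nat \<Rightarrow> real) \<Rightarrow> (nat \<Rightarrow>\<^sub>0 real)" where
  "coord_vec n f = (\<Sum>i<n. f i *\<^sub>R unit_vec i)"

lemma lookup_coord_vec: "Poly_Mapping.lookup (coord_vec n f) i = (if i < n then f i else 0)"
  by (simp add: coord_vec_def lookup_sum_unit_vec)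

lemma coord_vec_in_Rn: "coord_vec n f \<in> Rn n"
  by (simp add: mem_Rn_iff lookup_coord_vec)

text \<open>For \<open>g\<close> with values in {-1, 0, 1} this is the pattern on \<open>I\<close>
  scaled to Euclidean length 1 (when \<open>I\<close> lies below \<open>n\<close>); the zero pattern
  gives the zero vector.\<close>

definition sign_vec :: "nat \<Rightarrow> nat set \<Rightarrow> (nat \<Rightarrow> real) \<Rightarrow> (nat \<Rightarrow>\<^sub>0 real)" where
  "sign_vec n I g =
     coord_vec n (\<lambda>i. if i \<in> I then g i / sqrt (real (card {j \<in> I. g j \<noteq> 0})) else 0)"

text \<open>Fixing \<open>g\<close> to be 0 outside \<open>I\<close> leaves finitely many patterns
  to count.\<close>

definition sign_vecs :: "nat \<Rightarrow> nat set \<Rightarrow> (nat \<Rightarrow>\<^sub>0 real) set" where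
  "sign_vecs n I = sign_vec n I ` {g. (\<forall>i\<in>I. g i \<in> {-1, 0, 1}) \<and> (\<forall>i. i \<notin> I \<longrightarrow> g i = 0)}"

lemma card_sign_vecs:
  assumes "finite I"
  shows "finite (sign_vecs n I)" "card (sign_vecs n I) \<le> 3 ^ card I"
proof -
  let ?V = "{-1, 0, 1 :: real}"
  have "finite ?V" by simp
  note * = card_functions_with_support[OF assms this]
  show "finite (sign_vecs n I)" unfolding sign_vecs_def by (intro finite_imageI *)
  have "card (sign_vecs n I) \<le> card ?V ^ card I"
    unfolding sign_vecs_def by (rule order_trans[OF card_image_le[OF *(1)] *(2)])
  moreover have "card ?V = 3" by simp
  ultimately show "card (sign_vecs n I) \<le> 3 ^ card I" by (simp only:)
qed

text \<open>Having 0 among the points permits combinations whose weights sum to less than 1.\<close>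

lemma zero_in_sign_vecs: "0 \<in> sign_vecs n I"
proof -
  have "sign_vec n I (\<lambda>_. 0) = 0"
    by (rule poly_mapping_eqI) (simp add: sign_vec_def lookup_coord_vec)
  then show ?thesis unfolding sign_vecs_def by (intro image_eqI[where x = "\<lambda>_. 0"]) auto
qed

lemma lookup_sign_vecs_outside: "s \<in> sign_vecs n I \<Longrightarrow> i \<notin> I \<Longrightarrow> Poly_Mapping.lookup s i = 0"
  by (auto simp: sign_vecs_def sign_vec_def lookup_coord_vec)

lemma sum_square_sign_vecs_le:
  assumes "s \<in> sign_vecs n I" "I \<subseteq> {..<n}"
  shows "(\<Sum>i\<in>I. (Poly_Mapping.lookup s i)\<^sup>2) \<le> 1"
proof -
  obtain g where g: "s = sign_vec n I g" "\<And>i. i \<in> I \<Longrightarrow> g i \<in> {-1, 0, 1}"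
    using assms by (auto simp: sign_vecs_def)
  have I: "finite I" using assms finite_subset by blast
  define J where "J = {j \<in> I. g j \<noteq> 0}"
  have gJ: "(g i)\<^sup>2 = 1" if "i \<in> J" for i using g(2)[of i] that by (auto simp: J_def)
  have "(\<Sum>i\<in>I. (Poly_Mapping.lookup s i)\<^sup>2) = (\<Sum>i\<in>I. (g i / sqrt (real (card J)))\<^sup>2)"
    using assms(2) by (intro sum.cong) (auto simp: g sign_vec_def lookup_coord_vec J_def)
  also have "\<dots> = (\<Sum>i\<in>J. 1 / real (card J))"
    using I gJ by (intro sum.mono_neutral_cong_right) (auto simp: J_def power_divide)
  \<comment> \<open>An inequality only because the sum is 0 when \<open>J\<close> is empty.\<close>
  also have "\<dots> \<le> 1" by simp
  finally show ?thesis .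
qed

text \<open>On a support of \<open>m\<close> coordinates the pairing is at most the sum of
  \<open>m\<close> distinct weights over \<open>sqrt m\<close>, and \<open>m\<close> distinct
  weights sum to at most \<open>sqrt m\<close>. Only injectivity of the ranks matters, not which
  ranks occur.\<close>

lemma pairing_sign_vecs_le:
  assumes s: "s \<in> sign_vecs n I" and I: "I \<subseteq> {..<n}"
    and \<rho>: "inj_on \<rho> I" and h: "\<And>i. i \<in> I \<Longrightarrow> \<bar>h i\<bar> = sqrt_step (\<rho> i)"
  shows "pairing n h s \<le> 1"
proof -
  obtain g where g: "s = sign_vec n I g" "\<And>i. i \<in> I \<Longrightarrow> g i \<in> {-1, 0, 1}"
    using s by (auto simp: sign_vecs_def)
  have fI: "finite I" using I finite_subset by blast
  define J where "J = {j \<in> I. g j \<noteq> 0}"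
  have J: "finite J" "J \<subseteq> I" using fI by (auto simp: J_def)
  have "pairing n h s = (\<Sum>i\<in>J. h i * (g i / sqrt (real (card J))))"
    unfolding pairing_def using I
    by (intro sum.mono_neutral_cong_right) (auto simp: g sign_vec_def lookup_coord_vec J_def)
  also have "\<dots> \<le> (\<Sum>i\<in>J. sqrt_step (\<rho> i) * (1 / sqrt (real (card J))))"
  proof (intro sum_mono)
    fix i assume i: "i \<in> J"
    then have "i \<in> I" using J by auto
    then have "h i * g i \<le> sqrt_step (\<rho> i)" using g(2)[of i] h[of i] by (auto simp: abs_if split: if_splits)
    then show "h i * (g i / sqrt (real (card J))) \<le> sqrt_step (\<rho> i) * (1 / sqrt (real (card J)))"
      by (simp add: divide_right_mono)
  qed
  also have "\<dots> = (\<Sum>j\<in>\<rho> ` J. sqrt_step j) / sqrt (real (card J))"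
    using inj_on_subset[OF \<rho> J(2)] by (simp add: sum.reindex sum_divide_distrib)
  also have "\<dots> \<le> sqrt (real (card (\<rho> ` J))) / sqrt (real (card J))"
    using J by (intro divide_right_mono sum_sqrt_step_le) auto
  also have "\<dots> \<le> 1" using inj_on_subset[OF \<rho> J(2)] by (simp add: card_image)
  finally show ?thesis .
qed

lemma sign_vec_in_sign_vecs:
  assumes "\<And>i. i \<in> I \<Longrightarrow> g i \<in> {-1, 0, 1}"
  shows "sign_vec n I g \<in> sign_vecs n I"
proof -
  let ?g = "\<lambda>i. if i \<in> I then g i else 0"
  have "{j \<in> I. ?g j \<noteq> 0} = {j \<in> I. g j \<noteq> 0}" by auto
  then have "sign_vec n I g = sign_vec n I ?g"
    unfolding sign_vec_def by (intro arg_cong[of _ _ "coord_vec n"] ext) auto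
  then show ?thesis using assms unfolding sign_vecs_def by (intro image_eqI[where x = ?g]) auto
qed

text \<open>Exactly \<open>j + 1\<close> coordinates have rank at most \<open>j\<close>, so
  \<open>sqrt (real (Suc j))\<close> is the correct normalisation.\<close>

lemma layer_in_sign_vecs:
  assumes \<rho>: "bij_betw \<rho> I {..<card I}" and j: "j < card I"
    and \<sigma>: "\<And>i. i \<in> I \<Longrightarrow> \<sigma> i \<in> {-1, 1 :: real}"
  shows "coord_vec n (\<lambda>i. if i \<in> I \<and> \<rho> i \<le> j then \<sigma> i / sqrt (real (Suc j)) else 0) \<in> sign_vecs n I"
proof -
  let ?g = "\<lambda>i. if \<rho> i \<le> j then \<sigma> i else 0"
  have "\<And>i. i \<in> I \<Longrightarrow> \<sigma> i \<noteq> 0" using \<sigma> by fastforce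
  then have supp: "{i \<in> I. ?g i \<noteq> 0} = {i \<in> I. \<rho> i \<le> j}" by auto
  have "\<rho> ` I = {..<card I}" using \<rho> by (simp add: bij_betw_def)
  then have "\<rho> ` {i \<in> I. \<rho> i \<le> j} = {..j}"
    using j by (auto simp: set_eq_iff image_iff) (metis order_le_less_trans)
  then have "bij_betw \<rho> {i \<in> I. ?g i \<noteq> 0} {..j}"
    unfolding supp by (intro bij_betw_subset[OF \<rho>]) auto
  then have "card {i \<in> I. ?g i \<noteq> 0} = Suc j" using bij_betw_same_card by fastforce
  then have "coord_vec n (\<lambda>i. if i \<in> I \<and> \<rho> i \<le> j then \<sigma> i / sqrt (real (Suc j)) else 0) = sign_vec n I ?g"
    unfolding sign_vec_def by (intro arg_cong[of _ _ "coord_vec n"] ext) auto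
  moreover have "sign_vec n I ?g \<in> sign_vecs n I"
    using \<sigma> by (intro sign_vec_in_sign_vecs) auto
  ultimately show ?thesis by simp
qed

section \<open>Sums of sign vector polytopes\<close>

text \<open>
  The coordinates are split into \<open>A\<close> clusters (by \<open>outer\<close>) of \<open>B\<close> blocks (by \<open>inner\<close>) of size at
  most \<open>k\<close>; some blocks may be smaller or empty. Gauges are added within a cluster (\<open>\<ell>\<^sub>1\<close>-sum: unite
  the points, combine the functionals) and their maximum is taken over the clusters
  (\<open>\<ell>\<^sub>\<infinity>\<close>-sum: add the points, unite the functionals).
\<close>

locale block_structure =
  fixes n A B k :: nat and outer inner :: "nat \<Rightarrow> nat"
  assumes outer_less: "i < n \<Longrightarrow> outer i < A"
    and inner_less: "i < n \<Longrightarrow> inner i < B"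
    and card_block_le': "card {i. i < n \<and> outer i = p \<and> inner i = q} \<le> k"
    and pos: "A \<ge> 1" "B \<ge> 1" "k \<ge> 1"
begin

definition block :: "nat \<Rightarrow> nat \<Rightarrow> nat set" where
  "block p q = {i. i < n \<and> outer i = p \<and> inner i = q}"

definition cluster :: "nat \<Rightarrow> nat set" where
  "cluster p = {i. i < n \<and> outer i = p}"

definition cluster_points :: "nat \<Rightarrow> (nat \<Rightarrow>\<^sub>0 real) set" where
  "cluster_points p = (\<Union>q<B. sign_vecs n (block p q))"

text \<open>A Minkowski sum of sets. The clusters occupy disjoint coordinates, so its convex hull is
  the product of the hulls of the clusters.\<close>

definition points :: "(nat \<Rightarrow>\<^sub>0 real) set" where
  "points = (\<Sum>p<A. cluster_points p)"

text \<open>Ranks are injective within each block but may repeat across blocks: every block carries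
  its own Lorentz gauge, and the gauges of a cluster add up. Ranks range below \<open>k\<close> even
  in a shorter block, which keeps the count simple.\<close>

definition cluster_functionals :: "nat \<Rightarrow> (nat \<Rightarrow> real) set" where
  "cluster_functionals p = {h. (\<forall>i. i \<notin> cluster p \<longrightarrow> h i = 0) \<and>
     (\<exists>\<rho>. (\<forall>q<B. inj_on \<rho> (block p q)) \<and>
        (\<forall>i\<in>cluster p. \<rho> i < k \<and> \<bar>h i\<bar> = sqrt_step (\<rho> i)))}"

definition functionals :: "(nat \<Rightarrow> real) set" where
  "functionals = (\<Union>p<A. cluster_functionals p)"

lemma block_subset: "block p q \<subseteq> cluster p" "block p q \<subseteq> {..<n}"
  by (auto simp: block_def cluster_def)

lemma finite_block: "finite (block p q)"
  using block_subset(2) finite_subset by blast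

lemma finite_cluster: "finite (cluster p)"
  by (simp add: cluster_def)

lemma card_block_le: "card (block p q) \<le> k"
  using card_block_le' by (simp add: block_def)

lemma sum_cluster: "(\<Sum>i\<in>cluster p. f i) = (\<Sum>q<B. \<Sum>i\<in>block p q. f i)" for f :: "nat \<Rightarrow> real"
proof -
  have "(\<Sum>q<B. sum f {i \<in> cluster p. inner i = q}) = sum f (cluster p)"
    using inner_less by (intro sum.group finite_cluster) (auto simp: cluster_def)
  moreover have "{i \<in> cluster p. inner i = q} = block p q" for q
    by (auto simp: cluster_def block_def)
  ultimately show ?thesis by simp
qed

lemma sum_all: "(\<Sum>i<n. f i) = (\<Sum>p<A. \<Sum>i\<in>cluster p. f i)" for f :: "nat \<Rightarrow> real"
proof -
  have "(\<Sum>p<A. sum f {i \<in> {..<n}. outer i = p}) = sum f {..<n}"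
    using outer_less by (intro sum.group) auto
  then show ?thesis by (simp add: cluster_def)
qed

lemma card_cluster_le: "card (cluster p) \<le> B * k"
proof -
  have "real (card (cluster p)) = (\<Sum>q<B. real (card (block p q)))"
    using sum_cluster[of "\<lambda>_. 1" p] by simp
  also have "\<dots> \<le> (\<Sum>q<B. real k)"
    by (intro sum_mono) (simp add: card_block_le)
  also have "\<dots> = real (B * k)" by simp
  finally show ?thesis by (simp only: of_nat_le_iff)
qed

lemma card_cluster_points: "finite (cluster_points p)" "card (cluster_points p) \<le> B * 3 ^ k"
proof -
  show "finite (cluster_points p)"
    unfolding cluster_points_def using card_sign_vecs(1) finite_block by blast
  have "card (cluster_points p) \<le> (\<Sum>q<B. card (sign_vecs n (block p q)))"
    unfolding cluster_points_def by (rule card_UN_le) simp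
  also have "\<dots> \<le> (\<Sum>q<B. 3 ^ k)"
  proof (rule sum_mono)
    fix q
    have "card (sign_vecs n (block p q)) \<le> 3 ^ card (block p q)"
      by (rule card_sign_vecs[OF finite_block])
    also have "\<dots> \<le> 3 ^ k" by (rule power_increasing[OF card_block_le]) simp
    finally show "card (sign_vecs n (block p q)) \<le> 3 ^ k" .
  qed
  finally show "card (cluster_points p) \<le> B * 3 ^ k" by simp
qed

lemma card_points: "finite points" "card points \<le> (B * 3 ^ k) ^ A"
proof -
  have sub: "points \<subseteq> (\<lambda>f. \<Sum>p<A. f p) ` PiE {..<A} cluster_points"
  proof
    fix s assume "s \<in> points"
    then obtain f where f: "s = (\<Sum>p<A. f p)" "\<forall>p\<in>{..<A}. f p \<in> cluster_points p"
      unfolding points_def by (auto simp: set_sum_alt)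
    then have "s = (\<Sum>p<A. restrict f {..<A} p)" by simp
    moreover have "restrict f {..<A} \<in> PiE {..<A} cluster_points" using f by auto
    ultimately show "s \<in> (\<lambda>f. \<Sum>p<A. f p) ` PiE {..<A} cluster_points" by (rule image_eqI)
  qed
  have fin: "finite (PiE {..<A} cluster_points)"
    by (intro finite_PiE card_cluster_points) simp
  show "finite points" using sub fin finite_subset by blast
  have "card points \<le> card (PiE {..<A} cluster_points)"
    using sub fin by (meson card_image_le card_mono finite_imageI order_trans)
  also have "\<dots> = (\<Prod>p<A. card (cluster_points p))" by (simp add: card_PiE)
  also have "\<dots> \<le> (\<Prod>p<A. B * 3 ^ k)" by (intro prod_mono) (simp add: card_cluster_points)
  finally show "card points \<le> (B * 3 ^ k) ^ A" by simp
qed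

text \<open>Each of the at most \<open>B * k\<close> coordinates takes one of at most
  \<open>2 * k\<close> signed weights.\<close>

lemma card_cluster_functionals:
  "finite (cluster_functionals p)" "card (cluster_functionals p) \<le> (2 * k) ^ (B * k)"
proof -
  define V where "V = sqrt_step ` {..<k} \<union> (\<lambda>j. - sqrt_step j) ` {..<k}"
  have V: "finite V" by (simp add: V_def)
  have "card V \<le> card (sqrt_step ` {..<k}) + card ((\<lambda>j. - sqrt_step j) ` {..<k})"
    unfolding V_def by (rule card_Un_le)
  also have "\<dots> \<le> k + k"
    by (intro add_mono) (metis card_image_le card_lessThan finite_lessThan)+
  finally have cV: "card V \<le> 2 * k" by simp
  define X where "X = {h. (\<forall>i\<in>cluster p. h i \<in> V) \<and> (\<forall>i. i \<notin> cluster p \<longrightarrow> h i = 0)}"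
  note X = card_functions_with_support[OF finite_cluster[of p] V, folded X_def]
  have sub: "cluster_functionals p \<subseteq> X"
  proof
    fix h assume "h \<in> cluster_functionals p"
    then obtain \<rho> where h: "\<forall>i. i \<notin> cluster p \<longrightarrow> h i = 0"
      "\<forall>i\<in>cluster p. \<rho> i < k \<and> \<bar>h i\<bar> = sqrt_step (\<rho> i)"
      by (auto simp: cluster_functionals_def)
    have "h i \<in> V" if "i \<in> cluster p" for i
    proof -
      have "h i = sqrt_step (\<rho> i) \<or> h i = - sqrt_step (\<rho> i)" "\<rho> i < k"
        using h(2) that by (auto simp: abs_if split: if_splits)
      then show ?thesis by (auto simp: V_def)
    qed
    then show "h \<in> X" using h by (simp add: X_def)
  qed
  show "finite (cluster_functionals p)" using sub X finite_subset by blast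
  have "card (cluster_functionals p) \<le> card X" by (rule card_mono[OF X(1) sub])
  also have "\<dots> \<le> card V ^ card (cluster p)" by (rule X)
  also have "\<dots> \<le> (2 * k) ^ card (cluster p)" by (rule power_mono[OF cV]) simp
  also have "\<dots> \<le> (2 * k) ^ (B * k)" using pos by (intro power_increasing card_cluster_le) simp
  finally show "card (cluster_functionals p) \<le> (2 * k) ^ (B * k)" .
qed

lemma card_functionals: "finite functionals" "card functionals \<le> A * (2 * k) ^ (B * k)"
proof -
  show "finite functionals" using card_cluster_functionals by (auto simp: functionals_def)
  have "card functionals \<le> (\<Sum>p<A. card (cluster_functionals p))"
    unfolding functionals_def by (rule card_UN_le) simp
  also have "\<dots> \<le> (\<Sum>p<A. (2 * k) ^ (B * k))" by (intro sum_mono card_cluster_functionals)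
  finally show "card functionals \<le> A * (2 * k) ^ (B * k)" by simp
qed

lemma functionalsE:
  assumes "h \<in> functionals"
  obtains p \<rho> where "p < A" "\<And>i. i \<notin> cluster p \<Longrightarrow> h i = 0"
    "\<And>q. q < B \<Longrightarrow> inj_on \<rho> (block p q)"
    "\<And>i. i \<in> cluster p \<Longrightarrow> \<rho> i < k \<and> \<bar>h i\<bar> = sqrt_step (\<rho> i)"
  using assms unfolding functionals_def cluster_functionals_def by blast

text \<open>Within a block the ranks are distinct and below \<open>k\<close>, so each of the
  \<open>B\<close> blocks contributes at most the sum of all squared weights. This determines the
  inner radius.\<close>

lemma L2_set_functionals_le:
  assumes "h \<in> functionals"
  shows "L2_set h {..<n} \<le> sqrt (B * (1 + ln k))"
proof -
  obtain p \<rho> where p: "p < A" and h: "\<And>i. i \<notin> cluster p \<Longrightarrow> h i = 0"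
    and inj: "\<And>q. q < B \<Longrightarrow> inj_on \<rho> (block p q)"
    and \<rho>: "\<And>i. i \<in> cluster p \<Longrightarrow> \<rho> i < k \<and> \<bar>h i\<bar> = sqrt_step (\<rho> i)"
    using assms by (rule functionalsE) blast
  have "(\<Sum>i<n. (h i)\<^sup>2) = (\<Sum>i\<in>cluster p. (sqrt_step (\<rho> i))\<^sup>2)"
  proof (rule sum.mono_neutral_cong_right)
    show "(h i)\<^sup>2 = (sqrt_step (\<rho> i))\<^sup>2" if "i \<in> cluster p" for i
      using \<rho>[OF that] by (metis power2_abs)
  qed (use h in \<open>auto simp: cluster_def\<close>)
  also have "\<dots> = (\<Sum>q<B. \<Sum>i\<in>block p q. (sqrt_step (\<rho> i))\<^sup>2)" by (rule sum_cluster)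
  also have "\<dots> \<le> (\<Sum>q<B. 1 + ln k)"
  proof (rule sum_mono)
    fix q assume q: "q \<in> {..<B}"
    have "(\<Sum>i\<in>block p q. (sqrt_step (\<rho> i))\<^sup>2) = (\<Sum>j\<in>\<rho> ` block p q. (sqrt_step j)\<^sup>2)"
      using inj q by (simp add: sum.reindex)
    also have "\<dots> \<le> (\<Sum>j<k. (sqrt_step j)\<^sup>2)"
      using \<rho> block_subset by (intro sum_mono2) auto
    also have "\<dots> \<le> 1 + ln k" by (rule sum_sqrt_step_square_le[OF pos(3)])
    finally show "(\<Sum>i\<in>block p q. (sqrt_step (\<rho> i))\<^sup>2) \<le> 1 + ln k" .
  qed
  finally show ?thesis by (simp add: L2_set_def)
qed

text \<open>The summands have disjoint supports, so a coordinate sees only the summand of its own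
  cluster.\<close>

lemma points_cases:
  assumes "s \<in> points"
  obtains f where "\<And>p. p < A \<Longrightarrow> f p \<in> cluster_points p"
    "\<And>p i. p < A \<Longrightarrow> i \<in> cluster p \<Longrightarrow> Poly_Mapping.lookup s i = Poly_Mapping.lookup (f p) i"
proof -
  obtain f where f: "s = (\<Sum>p<A. f p)" "\<And>p. p < A \<Longrightarrow> f p \<in> cluster_points p"
    using assms unfolding points_def by (auto simp: set_sum_alt)
  have "Poly_Mapping.lookup s i = Poly_Mapping.lookup (f p) i" if "p < A" "i \<in> cluster p" for p i
  proof -
    have "Poly_Mapping.lookup (f p') i = 0" if p': "p' < A" "p' \<noteq> p" for p'
    proof -
      obtain q where "f p' \<in> sign_vecs n (block p' q)"
        using f(2)[of p'] p' by (auto simp: cluster_points_def)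
      then show ?thesis
        by (rule lookup_sign_vecs_outside)
          (use p' \<open>i \<in> cluster p\<close> in \<open>auto simp: cluster_def block_def\<close>)
    qed
    then have "(\<Sum>p'<A. Poly_Mapping.lookup (f p') i) = (\<Sum>p'\<in>{p}. Poly_Mapping.lookup (f p') i)"
      using that by (intro sum.mono_neutral_right) auto
    then show ?thesis by (simp add: f(1) lookup_sum)
  qed
  then show thesis using f(2) that by blast
qed

text \<open>Each of the \<open>A\<close> clusters contributes one sign vector of length at most
  1.\<close>

lemma L2_set_points_le:
  assumes "s \<in> points"
  shows "L2_set (Poly_Mapping.lookup s) {..<n} \<le> sqrt A"
proof -
  obtain f where f: "\<And>p. p < A \<Longrightarrow> f p \<in> cluster_points p"
    "\<And>p i. p < A \<Longrightarrow> i \<in> cluster p \<Longrightarrow> Poly_Mapping.lookup s i = Poly_Mapping.lookup (f p) i"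
    using points_cases[OF assms] by blast
  have "(\<Sum>i<n. (Poly_Mapping.lookup s i)\<^sup>2) = (\<Sum>p<A. \<Sum>i\<in>cluster p. (Poly_Mapping.lookup s i)\<^sup>2)"
    by (rule sum_all)
  also have "\<dots> \<le> (\<Sum>p<A. 1)"
  proof (rule sum_mono)
    fix p assume p: "p \<in> {..<A}"
    obtain q where q: "f p \<in> sign_vecs n (block p q)"
      using f(1) p by (auto simp: cluster_points_def)
    have "(\<Sum>i\<in>cluster p. (Poly_Mapping.lookup s i)\<^sup>2) = (\<Sum>i\<in>cluster p. (Poly_Mapping.lookup (f p) i)\<^sup>2)"
      using f(2) p by (intro sum.cong) auto
    also have "\<dots> = (\<Sum>i\<in>block p q. (Poly_Mapping.lookup (f p) i)\<^sup>2)"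
      using block_subset lookup_sign_vecs_outside[OF q]
      by (intro sum.mono_neutral_right finite_cluster) auto
    also have "\<dots> \<le> 1" by (rule sum_square_sign_vecs_le[OF q block_subset(2)])
    finally show "(\<Sum>i\<in>cluster p. (Poly_Mapping.lookup s i)\<^sup>2) \<le> 1" .
  qed
  finally show ?thesis by (simp add: L2_set_def)
qed

text \<open>A functional sees one cluster, and there the point is a single sign vector supported in
  one block, so the estimate for one block suffices.\<close>

lemma pairing_functionals_points_le:
  assumes h: "h \<in> functionals" and s: "s \<in> points"
  shows "pairing n h s \<le> 1"
proof -
  obtain p \<rho> where p: "p < A" and h: "\<And>i. i \<notin> cluster p \<Longrightarrow> h i = 0"
    and inj: "\<And>q. q < B \<Longrightarrow> inj_on \<rho> (block p q)"
    and \<rho>: "\<And>i. i \<in> cluster p \<Longrightarrow> \<rho> i < k \<and> \<bar>h i\<bar> = sqrt_step (\<rho> i)"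
    using h by (rule functionalsE) blast
  obtain f where f: "\<And>p. p < A \<Longrightarrow> f p \<in> cluster_points p"
    "\<And>p i. p < A \<Longrightarrow> i \<in> cluster p \<Longrightarrow> Poly_Mapping.lookup s i = Poly_Mapping.lookup (f p) i"
    using points_cases[OF s] by blast
  obtain q where q: "q < B" "f p \<in> sign_vecs n (block p q)"
    using f(1) p by (auto simp: cluster_points_def)
  have "pairing n h s = pairing n h (f p)"
    unfolding pairing_def using f(2)[OF p] h by (intro sum.cong refl) (metis mult_zero_left)
  also have "\<dots> \<le> 1"
    using \<rho> block_subset by (intro pairing_sign_vecs_le[OF q(2) _ inj[OF q(1)]]) auto
  finally show ?thesis .
qed

text \<open>The hard half of the duality. The functional is adapted to \<open>x\<close>: it takes
  the signs of \<open>x\<close> and, in each block, ranks the coordinates by decreasing absolute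
  value. Its value at \<open>x\<close> is then the total layer coefficient, so a value of at most 1
  makes the layer decomposition a subconvex combination of \<open>cluster_points p\<close>.\<close>

lemma cluster_part_in_hull:
  "\<exists>h\<in>cluster_functionals p. pairing n h x \<le> 1 \<longrightarrow>
     coord_vec n (\<lambda>i. if i \<in> cluster p then Poly_Mapping.lookup x i else 0) \<in> convex hull cluster_points p"
proof -
  \<comment> \<open>The sign of 0 is set to 1, so that \<open>h\<close> has the prescribed absolute
    value at zero coordinates too.\<close>
  define \<sigma> where "\<sigma> i = (if Poly_Mapping.lookup x i \<ge> 0 then 1 else -1 :: real)" for i
  have \<sigma>: "Poly_Mapping.lookup x i = \<sigma> i * \<bar>Poly_Mapping.lookup x i\<bar>" for i
    by (simp add: \<sigma>_def)
  define layered where "layered q \<rho> c \<longleftrightarrow>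
      bij_betw \<rho> (block p q) {..<card (block p q)} \<and> (\<forall>j. c j \<ge> 0) \<and>
      (\<forall>i\<in>block p q. Poly_Mapping.lookup x i =
         (\<Sum>j<card (block p q). c j * (if \<rho> i \<le> j then \<sigma> i / sqrt (real (Suc j)) else 0))) \<and>
      (\<Sum>j<card (block p q). c j) = (\<Sum>i\<in>block p q. \<bar>Poly_Mapping.lookup x i\<bar> * sqrt_step (\<rho> i))"
    for q \<rho> c
  have "\<exists>\<rho> c. layered q \<rho> c" for q
    unfolding layered_def by (rule layer_cake[OF finite_block \<sigma>])
  then obtain \<rho> c where layered: "\<And>q. layered q (\<rho> q) (c q)" by metis
  note * = layered[unfolded layered_def]
  note bij = *[THEN conjunct1]
  note c = *[THEN conjunct2, THEN conjunct1, rule_format]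
  note rep = *[THEN conjunct2, THEN conjunct2, THEN conjunct1, rule_format]
  note sumc = *[THEN conjunct2, THEN conjunct2, THEN conjunct2]
  \<comment> \<open>Each coordinate uses the ranking of its own block, selected by
    \<open>inner i\<close>.\<close>
  define h where "h i = (if i \<in> cluster p then \<sigma> i * sqrt_step (\<rho> (inner i) i) else 0)" for i
  have hF: "h \<in> cluster_functionals p"
  proof -
    have "inj_on (\<lambda>i. \<rho> (inner i) i) (block p q) \<longleftrightarrow> inj_on (\<rho> q) (block p q)" for q
      by (rule inj_on_cong) (simp add: block_def)
    then have "inj_on (\<lambda>i. \<rho> (inner i) i) (block p q)" for q
      using bij_betw_imp_inj_on[OF bij] by blast
    moreover have "\<rho> (inner i) i < k \<and> \<bar>h i\<bar> = sqrt_step (\<rho> (inner i) i)" if "i \<in> cluster p" for i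
    proof -
      have "i \<in> block p (inner i)" using that by (auto simp: cluster_def block_def)
      then have "\<rho> (inner i) i < card (block p (inner i))"
        using bij_betw_apply[OF bij] by blast
      then have "\<rho> (inner i) i < k" using card_block_le order_less_le_trans by blast
      then show ?thesis using that sqrt_step_nonneg by (simp add: h_def \<sigma>_def abs_mult)
    qed
    ultimately show ?thesis
      unfolding cluster_functionals_def
      by (auto intro!: exI[of _ "\<lambda>i. \<rho> (inner i) i"] simp: h_def)
  qed
  moreover have "coord_vec n (\<lambda>i. if i \<in> cluster p then Poly_Mapping.lookup x i else 0)
      \<in> convex hull cluster_points p" (is "?x \<in> _") if le1: "pairing n h x \<le> 1"
  proof -
    \<comment> \<open>All layers of all blocks of the cluster, indexed together so that one
      combination covers the cluster.\<close>
    define I where "I = (SIGMA q:{..<B}. {..<card (block p q)})"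
    define y where "y q j = coord_vec n (\<lambda>i. if i \<in> block p q \<and> \<rho> q i \<le> j
       then \<sigma> i / sqrt (real (Suc j)) else 0)" for q j
    have "pairing n h x = (\<Sum>i\<in>cluster p. \<bar>Poly_Mapping.lookup x i\<bar> * sqrt_step (\<rho> (inner i) i))"
      unfolding pairing_def
      by (rule sum.mono_neutral_cong_right) (auto simp: h_def cluster_def \<sigma>_def)
    also have "\<dots> = (\<Sum>q<B. \<Sum>i\<in>block p q. \<bar>Poly_Mapping.lookup x i\<bar> * sqrt_step (\<rho> (inner i) i))"
      by (rule sum_cluster)
    also have "\<dots> = (\<Sum>q<B. \<Sum>i\<in>block p q. \<bar>Poly_Mapping.lookup x i\<bar> * sqrt_step (\<rho> q i))"
      by (intro sum.cong refl) (auto simp: block_def)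
    also have "\<dots> = (\<Sum>q<B. \<Sum>j<card (block p q). c q j)" by (simp add: sumc)
    also have "\<dots> = (\<Sum>z\<in>I. c (fst z) (snd z))"
      unfolding I_def by (subst sum.Sigma) (auto simp: case_prod_unfold)
    finally have sum_le: "(\<Sum>z\<in>I. c (fst z) (snd z)) \<le> 1" using le1 by simp
    have yG: "y q j \<in> cluster_points p" if "(q, j) \<in> I" for q j
    proof -
      have "y q j \<in> sign_vecs n (block p q)"
        unfolding y_def using that
        by (intro layer_in_sign_vecs[OF bij]) (auto simp: I_def \<sigma>_def)
      then show ?thesis using that by (auto simp: cluster_points_def I_def)
    qed
    have "0 \<in> cluster_points p"
      using zero_in_sign_vecs[of n "block p 0"] pos by (auto simp: cluster_points_def)
    then have "(\<Sum>z\<in>I. c (fst z) (snd z) *\<^sub>R y (fst z) (snd z)) \<in> convex hull cluster_points p"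
      using sum_le c yG by (intro convex_sum_le_1 hull_inc) (auto simp: I_def)
    moreover have "?x = (\<Sum>z\<in>I. c (fst z) (snd z) *\<^sub>R y (fst z) (snd z))"
    proof (rule poly_mapping_eqI)
      fix i
      have "Poly_Mapping.lookup (\<Sum>z\<in>I. c (fst z) (snd z) *\<^sub>R y (fst z) (snd z)) i
          = (\<Sum>z\<in>I. c (fst z) (snd z) * Poly_Mapping.lookup (y (fst z) (snd z)) i)"
        by (simp add: lookup_sum lookup_scaleR)
      also have "\<dots> = (\<Sum>q<B. \<Sum>j<card (block p q). c q j * Poly_Mapping.lookup (y q j) i)"
        unfolding I_def by (subst sum.Sigma) (auto simp: case_prod_unfold)
      also have "\<dots> = Poly_Mapping.lookup ?x i"
      proof (cases "i \<in> cluster p")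
        case True
        then have i: "i < n" "i \<in> block p (inner i)" "inner i < B"
          using inner_less by (auto simp: cluster_def block_def)
        have "(\<Sum>q<B. \<Sum>j<card (block p q). c q j * Poly_Mapping.lookup (y q j) i)
            = (\<Sum>q\<in>{inner i}. \<Sum>j<card (block p q). c q j * Poly_Mapping.lookup (y q j) i)"
          using i by (intro sum.mono_neutral_right) (auto simp: y_def lookup_coord_vec block_def)
        also have "\<dots> = Poly_Mapping.lookup x i"
          using i by (simp add: y_def lookup_coord_vec rep[OF i(2)])
        finally show ?thesis using True i by (simp add: lookup_coord_vec)
      next
        case False
        then have "i \<notin> block p q" for q using block_subset by blast
        then show ?thesis using False by (simp add: y_def lookup_coord_vec)
      qed
      finally show "Poly_Mapping.lookup ?x i =
        Poly_Mapping.lookup (\<Sum>z\<in>I. c (fst z) (snd z) *\<^sub>R y (fst z) (snd z)) i" by simp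
    qed
    ultimately show ?thesis by simp
  qed
  ultimately show ?thesis by blast
qed

lemma functionals_nonempty: "functionals \<noteq> {}"
  using cluster_part_in_hull[of 0 0] pos by (auto simp: functionals_def)

lemma points_subset_Rn: "points \<subseteq> Rn n"
proof
  fix s assume "s \<in> points"
  then obtain f where f: "s = (\<Sum>p<A. f p)" "\<And>p. p < A \<Longrightarrow> f p \<in> cluster_points p"
    unfolding points_def by (auto simp: set_sum_alt)
  have "cluster_points p \<subseteq> Rn n" for p
    by (auto simp: cluster_points_def sign_vecs_def sign_vec_def coord_vec_in_Rn)
  then show "s \<in> Rn n" unfolding f(1)
    using f(2) by (intro subspace_sum subspace_Rn) auto
qed

text \<open>For the inclusion from right to left, \<open>x\<close> is cut into its cluster parts.
  Each part lies in the hull of its cluster, and a Minkowski sum of hulls is the hull of the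
  Minkowski sum.\<close>

lemma convex_hull_points:
  "convex hull points = {x \<in> Rn n. \<forall>h\<in>functionals. pairing n h x \<le> 1}"
proof
  have "convex {x. pairing n h x \<le> 1}" for h
    using convex_linear_vimage[OF linear_pairing[of n h], of "{..1}"] by (simp add: vimage_def)
  moreover have "{x \<in> Rn n. \<forall>h\<in>functionals. pairing n h x \<le> 1}
      = Rn n \<inter> (\<Inter>h\<in>functionals. {x. pairing n h x \<le> 1})" by auto
  ultimately have "convex {x \<in> Rn n. \<forall>h\<in>functionals. pairing n h x \<le> 1}"
    using subspace_imp_convex[OF subspace_Rn] by (auto intro!: convex_Int convex_INT)
  then show "convex hull points \<subseteq> {x \<in> Rn n. \<forall>h\<in>functionals. pairing n h x \<le> 1}"
    using points_subset_Rn pairing_functionals_points_le by (intro hull_minimal) auto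
  show "{x \<in> Rn n. \<forall>h\<in>functionals. pairing n h x \<le> 1} \<subseteq> convex hull points"
  proof safe
    fix x assume x: "x \<in> Rn n" and le1: "\<forall>h\<in>functionals. pairing n h x \<le> 1"
    define y where "y p = coord_vec n (\<lambda>i. if i \<in> cluster p then Poly_Mapping.lookup x i else 0)" for p
    have "y p \<in> convex hull cluster_points p" if "p < A" for p
      using cluster_part_in_hull[of p x] le1 that by (auto simp: functionals_def y_def)
    then have "(\<Sum>p<A. y p) \<in> (\<Sum>p<A. convex hull cluster_points p)"
      by (auto simp: set_sum_alt)
    then have "(\<Sum>p<A. y p) \<in> convex hull points"
      by (simp add: points_def convex_hull_set_sum)
    moreover have "x = (\<Sum>p<A. y p)"
    proof (rule Rn_eqI[OF x])
      show "(\<Sum>p<A. y p) \<in> Rn n" by (intro subspace_sum subspace_Rn) (simp add: y_def coord_vec_in_Rn)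
      fix i assume i: "i < n"
      have "Poly_Mapping.lookup (\<Sum>p<A. y p) i = (\<Sum>p<A. if p = outer i then Poly_Mapping.lookup x i else 0)"
        using i by (auto simp: lookup_sum y_def lookup_coord_vec cluster_def intro!: sum.cong)
      then show "Poly_Mapping.lookup x i = Poly_Mapping.lookup (\<Sum>p<A. y p) i"
        using outer_less[OF i] by simp
    qed
    ultimately show "x \<in> convex hull points" by simp
  qed
qed

end

text \<open>Coordinates are laid out consecutively, \<open>k\<close> to a block and \<open>B\<close>
  blocks to a cluster; whatever exceeds \<open>n\<close> is missing from the last blocks. The radii
  are \<open>r = 1 / sqrt (B * (1 + ln k))\<close> and \<open>R = sqrt A\<close>.\<close>

lemma exists_block_polytope:
  fixes n A B k :: nat
  assumes pos: "A \<ge> 1" "B \<ge> 1" "k \<ge> 1" and n: "n \<le> A * (B * k)"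
  shows "\<exists>P r R. polytope P \<and> P \<subseteq> Rn n \<and> affdim P = int n \<and> 0 < r \<and> r \<le> R \<and>
    (*\<^sub>R) r ` B2 n \<subseteq> P \<and> P \<subseteq> (*\<^sub>R) R ` B2 n \<and>
    card (facets P) \<le> A * (2 * k) ^ (B * k) \<and> card (vertices P) \<le> (B * 3 ^ k) ^ A \<and>
    (R / r)\<^sup>2 = real A * real B * (1 + ln (real k))"
proof -
  interpret block_structure n A B k "\<lambda>i. i div (B * k)" "\<lambda>i. (i div k) mod B"
  proof
    fix i assume "i < n"
    then show "i div (B * k) < A" using n pos by (simp add: less_mult_imp_div_less)
    show "(i div k) mod B < B" using pos by simp
  next
    fix p q
    \<comment> \<open>Block \<open>q\<close> of cluster \<open>p\<close> is contained in an interval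
      of \<open>k\<close> consecutive indices.\<close>
    have "i \<in> {(p * B + q) * k..<(p * B + q) * k + k}"
      if "i div (B * k) = p" "(i div k) mod B = q" for i
    proof -
      have "i div k div B = p" using that(1) by (simp add: div_mult2_eq mult.commute[of B])
      then have "i div k = p * B + q" using that(2) div_mult_mod_eq[of "i div k" B] by simp
      then have "(p * B + q) * k + i mod k = i" using div_mult_mod_eq[of i k] by simp
      moreover have "i mod k < k" using pos by simp
      ultimately show ?thesis by (simp only: atLeastLessThan_iff) linarith
    qed
    then have sub: "{i. i < n \<and> i div (B * k) = p \<and> (i div k) mod B = q}
        \<subseteq> {(p * B + q) * k..<(p * B + q) * k + k}" by blast
    then show "card {i. i < n \<and> i div (B * k) = p \<and> (i div k) mod B = q} \<le> k"
      using card_mono[OF finite_atLeastLessThan sub] by simp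
  qed (use pos in auto)
  define t where "t = real B * (1 + ln (real k))"
  have t: "t \<ge> 1"
  proof -
    have "1 * 1 \<le> real B * (1 + ln (real k))" using pos by (intro mult_mono) auto
    then show ?thesis by (simp add: t_def)
  qed
  define r where "r = 1 / sqrt t"
  have r: "0 < r" "r \<le> 1" using t by (auto simp: r_def)
  have hr: "r * L2_set h {..<n} \<le> 1" if "h \<in> functionals" for h
    using L2_set_functionals_le[OF that] t by (simp add: r_def t_def divide_le_eq)
  have A: "0 < sqrt (real A)" "1 \<le> sqrt (real A)" using pos by auto
  note P = polytope_with_polar_description[OF card_points(1) card_functionals(1) functionals_nonempty
      convex_hull_points r(1) hr A(1) L2_set_points_le]
  have "(sqrt A / r)\<^sup>2 = real A * real B * (1 + ln (real k))"
    using t by (simp add: r_def power_mult_distrib) (simp add: t_def)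
  then show ?thesis
    using P(1-5) r(1) order_trans[OF r(2) A(2)] order_trans[OF P(6) card_functionals(2)]
      order_trans[OF P(7) card_points(2)]
    by blast
qed

section \<open>Choice of parameters and asymptotic bounds\<close>

lemma ln_card_mono:
  assumes "c \<le> m" "m \<ge> 1"
  shows "ln (real c) \<le> ln (real m)"
  \<comment> \<open>For \<open>c = 0\<close> the convention \<open>ln 0 = 0\<close> applies, and
    \<open>m \<ge> 1\<close> makes the right side nonnegative.\<close>
  using assms by (cases "c = 0") auto

lemma nat_ceiling_bounds:
  fixes x :: real
  assumes "x \<ge> 1"
  shows "x \<le> real (nat \<lceil>x\<rceil>)" "real (nat \<lceil>x\<rceil>) \<le> 2 * x" "nat \<lceil>x\<rceil> \<ge> 1"
  using assms by linarith+

text \<open>The factor 4 is chosen so that \<open>4 * x\<close> dominates \<open>A\<close>,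
  \<open>B\<close> and \<open>2 * k\<close> when \<open>x\<close> is the dimension. The constant 3
  is 1 plus the bound 2 for \<open>ln 4\<close>.\<close>

lemma ln_le_powr:
  fixes x \<eta> :: real
  assumes "1 \<le> x" "0 < \<eta>"
  shows "1 + ln (4 * x) \<le> (3 + 1 / \<eta>) * x powr \<eta>"
proof -
  have "ln (4 :: real) \<le> 2"
    using ln_realpow[of 2 2] ln_le_minus_one[of 2] by simp
  moreover have "1 \<le> x powr \<eta>" using assms by (simp add: ge_one_powr_ge_zero)
  moreover have "ln x \<le> x powr \<eta> / \<eta>" by (rule ln_powr_bound[OF assms])
  ultimately show ?thesis using assms by (simp add: ln_mult algebra_simps)
qed

text \<open>With \<open>N\<close> the dimension, \<open>k\<close>, \<open>B\<close>,
  \<open>A\<close> are of order at most \<open>N powr \<kappa>\<close>,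
  \<open>N powr \<beta>\<close>, \<open>N powr (a + \<eta>)\<close>. Moving \<open>\<eta>\<close>
  from the block size to the number of clusters pays for the logarithm in the facet count and leaves
  the vertex exponent at exactly \<open>a + \<delta> * (1 - a)\<close>. The ratio of the radii pays
  \<open>2 * \<eta>\<close>: once for \<open>A\<close>, once for its logarithm.\<close>

lemma exists_polytope_bounds:
  fixes a \<delta> :: real
  assumes a: "0 < a" "a < 1" and \<delta>: "0 < \<delta>" "\<delta> < 1"
  shows "\<exists>C\<ge>1. \<forall>n\<ge>1. \<exists>P r R.
    polytope P \<and> P \<subseteq> Rn n \<and> affdim P = int n \<and> 0 < r \<and> r \<le> R \<and>
    (*\<^sub>R) r ` B2 n \<subseteq> P \<and> P \<subseteq> (*\<^sub>R) R ` B2 n \<and>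
    ln (real (card (facets P))) \<le> C * real n powr (1 - a) \<and>
    ln (real (card (vertices P))) \<le> C * real n powr (a + \<delta> * (1 - a)) \<and>
    (R / r)\<^sup>2 \<le> C * real n powr (1 - \<delta> + a)"
proof -
  \<comment> \<open>The Figiel--Lindenstrauss--Milman inequality only forces \<open>(R / r)\<^sup>2\<close> to be of order \<open>n powr (1 - \<delta> + a * \<delta>)\<close>;
    \<open>\<eta>\<close> spends the surplus exponent \<open>a * (1 - \<delta>)\<close> on absorbing the logarithms.\<close>
  define \<eta> where "\<eta> = min (\<delta> * (1 - a)) (a * (1 - \<delta>)) / 2"
  define \<kappa> where "\<kappa> = \<delta> * (1 - a) - \<eta>"
  define \<beta> where "\<beta> = (1 - a) * (1 - \<delta>)"
  have pos: "0 < \<delta> * (1 - a)" "0 < a * (1 - \<delta>)" "0 < \<beta>" using a \<delta> by (auto simp: \<beta>_def)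
  have le: "\<delta> * (1 - a) \<le> 1 - a" "\<beta> \<le> 1 - a" using a \<delta> by (auto simp: \<beta>_def mult_le_cancel_right1 mult_le_cancel_left1)
  have \<eta>: "0 < \<eta>" "2 * \<eta> \<le> a * (1 - \<delta>)" "2 * \<eta> \<le> \<delta> * (1 - a)"
    using pos by (auto simp: \<eta>_def)
  have \<kappa>: "0 < \<kappa>" "\<kappa> \<le> 1" using \<eta> pos le a unfolding \<kappa>_def by linarith+
  have \<beta>: "0 < \<beta>" "\<beta> \<le> 1" using pos le a by auto
  have a\<eta>: "0 < a + \<eta>" "a + \<eta> \<le> 1" "\<eta> \<le> 1 - a" using \<eta> le pos a by linarith+
  have exps: "\<beta> + \<kappa> + \<eta> = 1 - a" "(a + \<eta>) + \<kappa> = a + \<delta> * (1 - a)" "1 - (\<beta> + \<kappa>) = a + \<eta>"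
    "(a + \<eta>) + \<beta> + \<eta> \<le> 1 - \<delta> + a"
    using \<eta> by (auto simp: \<beta>_def \<kappa>_def algebra_simps)
  define K where "K = 3 + 1 / \<eta>"
  \<comment> \<open>For vertices, \<open>ln B\<close> is compared with the block size
    \<open>N powr \<kappa>\<close>, hence a second constant.\<close>
  define L where "L = 3 + 1 / \<kappa>"
  define C where "C = 5 * K + 2 * (L + 4)"
  have KL: "K \<ge> 1" "L \<ge> 1" using \<eta> \<kappa> by (auto simp: K_def L_def)
  have C: "1 \<le> C" "5 * K \<le> C" "2 * (L + 4) \<le> C" "4 * K \<le> C" using KL by (auto simp: C_def)
  have "\<exists>P r R.
    polytope P \<and> P \<subseteq> Rn n \<and> affdim P = int n \<and> 0 < r \<and> r \<le> R \<and>
    (*\<^sub>R) r ` B2 n \<subseteq> P \<and> P \<subseteq> (*\<^sub>R) R ` B2 n \<and>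
    ln (real (card (facets P))) \<le> C * real n powr (1 - a) \<and>
    ln (real (card (vertices P))) \<le> C * real n powr (a + \<delta> * (1 - a)) \<and>
    (R / r)\<^sup>2 \<le> C * real n powr (1 - \<delta> + a)" if n: "n \<ge> 1" for n
  proof -
    define N where "N = real n"
    have N: "N \<ge> 1" using n by (simp add: N_def)
    have powr1: "1 \<le> N powr t" if "0 \<le> t" for t using N that by (simp add: ge_one_powr_ge_zero)
    have powr_le: "N powr s \<le> N powr t" if "s \<le> t" for s t using N that by (simp add: powr_mono)
    have powrN: "N powr t \<le> N" if "t \<le> 1" for t using powr_le[OF that] N by simp
    define k where "k = nat \<lceil>N powr \<kappa>\<rceil>"
    define B where "B = nat \<lceil>N powr \<beta>\<rceil>"
    \<comment> \<open>Rounding up ensures \<open>n \<le> A * (B * k)\<close>; the extra 1 costs only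
      a factor 2 in the bound on \<open>A\<close>.\<close>
    define A where "A = n div (B * k) + 1"
    have k: "N powr \<kappa> \<le> real k" "real k \<le> 2 * N powr \<kappa>" "k \<ge> 1"
      unfolding k_def using \<kappa> by (intro nat_ceiling_bounds powr1; simp)+
    have B: "N powr \<beta> \<le> real B" "real B \<le> 2 * N powr \<beta>" "B \<ge> 1"
      unfolding B_def using \<beta> by (intro nat_ceiling_bounds powr1; simp)+
    have A1: "A \<ge> 1" by (simp add: A_def)
    have A: "real A \<le> 2 * N powr (a + \<eta>)"
    proof -
      have "real (n div (B * k)) \<le> N / (real B * real k)"
        using of_nat_div_le_of_nat[of n "B * k"] by (simp add: N_def)
      also have "\<dots> \<le> N / (N powr \<beta> * N powr \<kappa>)"
        using B k N by (intro divide_left_mono mult_mono mult_pos_pos) auto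
      also have "\<dots> = N powr (1 - (\<beta> + \<kappa>))"
        using N by (simp add: powr_diff powr_add)
      also have "\<dots> = N powr (a + \<eta>)" by (simp only: exps)
      finally show ?thesis using powr1[of "a + \<eta>"] a\<eta> by (simp add: A_def)
    qed
    have "n \<le> A * (B * k)"
      using B k dividend_less_div_times[of "B * k" n] by (simp add: A_def)
    then obtain P r R where P: "polytope P" "P \<subseteq> Rn n" "affdim P = int n" "0 < r" "r \<le> R"
      "(*\<^sub>R) r ` B2 n \<subseteq> P" "P \<subseteq> (*\<^sub>R) R ` B2 n"
      and F: "card (facets P) \<le> A * (2 * k) ^ (B * k)"
      and V: "card (vertices P) \<le> (B * 3 ^ k) ^ A"
      and Rr: "(R / r)\<^sup>2 = real A * real B * (1 + ln (real k))"
      using exists_block_polytope[OF A1 B(3) k(3), of n] by blast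
    have kN: "2 * real k \<le> 4 * N" using k powrN[OF \<kappa>(2)] by simp
    have BN: "real B \<le> 4 * N" using B powrN[OF \<beta>(2)] N by simp
    have AN: "real A \<le> 4 * N" using A powrN[OF a\<eta>(2)] N by simp
    have lnK: "1 + ln (4 * N) \<le> K * N powr \<eta>" unfolding K_def by (rule ln_le_powr[OF N \<eta>(1)])
    have lnL: "1 + ln (4 * N) \<le> L * N powr \<kappa>" unfolding L_def by (rule ln_le_powr[OF N \<kappa>(1)])
    have ln_bounds: "ln (real A) \<le> ln (4 * N)" "ln (real B) \<le> ln (4 * N)"
      "ln (2 * real k) \<le> ln (4 * N)" "ln (real k) \<le> ln (4 * N)"
      using AN BN kN A1 B(3) k(3) by simp_all
    have "ln (real (card (facets P))) \<le> C * N powr (1 - a)"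
    proof -
      have "ln (real (card (facets P))) \<le> ln (real (A * (2 * k) ^ (B * k)))"
        using A1 k by (intro ln_card_mono[OF F]) simp
      also have "\<dots> = ln (real A) + real B * real k * ln (2 * real k)"
        using A1 k by (simp add: ln_mult ln_realpow algebra_simps)
      \<comment> \<open>The first term bounds \<open>ln A\<close>; the second has exponent
        \<open>\<beta> + \<kappa> + \<eta> = 1 - a\<close>, whence the total constant
        \<open>5 * K\<close>.\<close>
      also have "\<dots> \<le> K * N powr (1 - a) + (2 * N powr \<beta>) * (2 * N powr \<kappa>) * (K * N powr \<eta>)"
      proof (intro add_mono mult_mono)
        have "ln (real A) \<le> K * N powr \<eta>" using ln_bounds(1) lnK by linarith
        also have "\<dots> \<le> K * N powr (1 - a)" using KL powr_le[OF a\<eta>(3)] by simp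
        finally show "ln (real A) \<le> K * N powr (1 - a)" .
        show "ln (2 * real k) \<le> K * N powr \<eta>" using ln_bounds(3) lnK by linarith
      qed (use B k in auto)
      also have "\<dots> = K * N powr (1 - a) + 4 * K * N powr (\<beta> + \<kappa> + \<eta>)"
        by (simp add: powr_add)
      also have "\<dots> = 5 * K * N powr (1 - a)" by (simp add: exps)
      also have "\<dots> \<le> C * N powr (1 - a)" using C by (intro mult_right_mono) auto
      finally show ?thesis .
    qed
    moreover have "ln (real (card (vertices P))) \<le> C * N powr (a + \<delta> * (1 - a))"
    proof -
      have "ln (real (card (vertices P))) \<le> ln (real ((B * 3 ^ k) ^ A))"
        using B by (intro ln_card_mono[OF V]) simp
      also have "\<dots> = real A * (ln (real B) + real k * ln 3)"
        using B by (simp add: ln_mult ln_realpow)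
      also have "\<dots> \<le> (2 * N powr (a + \<eta>)) * (L * N powr \<kappa> + (2 * N powr \<kappa>) * 2)"
      proof (intro mult_mono add_mono)
        show "ln (real B) \<le> L * N powr \<kappa>" using ln_bounds(2) lnL by linarith
        show "ln 3 \<le> (2 :: real)" using ln_le_minus_one[of 3] by simp
      qed (use A k B KL in auto)
      also have "\<dots> = 2 * (L + 4) * N powr ((a + \<eta>) + \<kappa>)"
        by (simp add: powr_add algebra_simps)
      also have "\<dots> \<le> C * N powr (a + \<delta> * (1 - a))"
        unfolding exps(2) using C by (intro mult_right_mono) auto
      finally show ?thesis .
    qed
    moreover have "(R / r)\<^sup>2 \<le> C * N powr (1 - \<delta> + a)"
    proof -
      have "(R / r)\<^sup>2 \<le> (2 * N powr (a + \<eta>)) * (2 * N powr \<beta>) * (K * N powr \<eta>)"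
        unfolding Rr
      proof (intro mult_mono A B)
        show "1 + ln (real k) \<le> K * N powr \<eta>" using ln_bounds(4) lnK by linarith
      qed (use A k B in auto)
      also have "\<dots> = 4 * K * N powr ((a + \<eta>) + \<beta> + \<eta>)"
        by (simp only: powr_add) simp
      also have "\<dots> \<le> C * N powr (1 - \<delta> + a)"
        using C KL powr_le[OF exps(4)] by (intro mult_mono) auto
      finally show ?thesis .
    qed
    ultimately show ?thesis using P unfolding N_def by blast
  qed
  then show ?thesis using C(1) by blast
qed

text \<open>Multiplying the three bounds adds the exponents to \<open>2 + a * (1 - \<delta>)\<close>
  and cubes the constant; as \<open>C \<ge> 1\<close>, the cube serves for all four
  estimates.\<close>

lemma exists_polytope_sequence:
  fixes a \<delta> :: real
  assumes a: "0 < a" "a < 1" and \<delta>: "0 < \<delta>" "\<delta> < 1"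
  shows "\<exists>C>0. \<exists>(P :: nat \<Rightarrow> (nat \<Rightarrow>\<^sub>0 real) set) (r :: nat \<Rightarrow> real) (R :: nat \<Rightarrow> real). \<forall>n\<ge>1.
    polytope (P n) \<and> P n \<subseteq> Rn n \<and> affdim (P n) = int n \<and> 0 < r n \<and> r n \<le> R n \<and>
    (*\<^sub>R) (r n) ` B2 n \<subseteq> P n \<and> P n \<subseteq> (*\<^sub>R) (R n) ` B2 n \<and>
    ln (real (card (facets (P n)))) \<le> C * real n powr (1 - a) \<and>
    ln (real (card (vertices (P n)))) \<le> C * real n powr (a + \<delta> * (1 - a)) \<and>
    (R n / r n)\<^sup>2 \<le> C * real n powr (1 - \<delta> + a) \<and>
    ln (real (card (vertices (P n)))) * ln (real (card (facets (P n)))) * (R n / r n)\<^sup>2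
      \<le> C * real n powr (2 + a * (1 - \<delta>))"
proof -
  define good where "good C n P r R \<longleftrightarrow>
    polytope P \<and> P \<subseteq> Rn n \<and> affdim P = int n \<and> 0 < r \<and> r \<le> R \<and>
    (*\<^sub>R) r ` B2 n \<subseteq> P \<and> P \<subseteq> (*\<^sub>R) R ` B2 n \<and>
    ln (real (card (facets P))) \<le> C * real n powr (1 - a) \<and>
    ln (real (card (vertices P))) \<le> C * real n powr (a + \<delta> * (1 - a)) \<and>
    (R / r)\<^sup>2 \<le> C * real n powr (1 - \<delta> + a)" for C n P and r R :: real
  obtain C where C: "C \<ge> 1" and "\<And>n. n \<ge> 1 \<Longrightarrow> \<exists>P r R. good C n P r R"
    using exists_polytope_bounds[OF assms] unfolding good_def by blast
  then obtain P r R where good: "\<And>n. n \<ge> 1 \<Longrightarrow> good C n (P n) (r n) (R n)" by metis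
  have C3: "C \<le> C ^ 3" using C self_le_power[of C 3] by simp
  have up: "C * real n powr t \<le> C ^ 3 * real n powr t" for n :: nat and t
    using C3 by (intro mult_right_mono) auto
  have "polytope (P n) \<and> P n \<subseteq> Rn n \<and> affdim (P n) = int n \<and> 0 < r n \<and> r n \<le> R n \<and>
    (*\<^sub>R) (r n) ` B2 n \<subseteq> P n \<and> P n \<subseteq> (*\<^sub>R) (R n) ` B2 n \<and>
    ln (real (card (facets (P n)))) \<le> C ^ 3 * real n powr (1 - a) \<and>
    ln (real (card (vertices (P n)))) \<le> C ^ 3 * real n powr (a + \<delta> * (1 - a)) \<and>
    (R n / r n)\<^sup>2 \<le> C ^ 3 * real n powr (1 - \<delta> + a) \<and>
    ln (real (card (vertices (P n)))) * ln (real (card (facets (P n)))) * (R n / r n)\<^sup>2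
      \<le> C ^ 3 * real n powr (2 + a * (1 - \<delta>))" if n: "n \<ge> 1" for n
  proof -
    note g = good[OF n, unfolded good_def]
    have f: "ln (real (card (facets (P n)))) \<le> C * real n powr (1 - a)"
      and v: "ln (real (card (vertices (P n)))) \<le> C * real n powr (a + \<delta> * (1 - a))"
      and q: "(R n / r n)\<^sup>2 \<le> C * real n powr (1 - \<delta> + a)"
      using g by blast+
    \<comment> \<open>Logarithms of natural numbers are nonnegative, including
      \<open>ln 0 = 0\<close>, so the bounds may be multiplied.\<close>
    have ln0: "0 \<le> ln (real m)" for m by (cases "m = 0") auto
    have "ln (real (card (vertices (P n)))) * ln (real (card (facets (P n)))) * (R n / r n)\<^sup>2
        \<le> (C * real n powr (a + \<delta> * (1 - a))) * (C * real n powr (1 - a)) * (C * real n powr (1 - \<delta> + a))"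
      using C by (intro mult_mono f v q ln0 mult_nonneg_nonneg) auto
    also have "\<dots> = C ^ 3 * real n powr ((a + \<delta> * (1 - a)) + (1 - a) + (1 - \<delta> + a))"
      by (simp only: powr_add power3_eq_cube mult_ac)
    also have "(a + \<delta> * (1 - a)) + (1 - a) + (1 - \<delta> + a) = 2 + a * (1 - \<delta>)"
      by (simp add: algebra_simps)
    finally show ?thesis
      using g order_trans[OF f up] order_trans[OF v up] order_trans[OF q up] by blast
  qed
  moreover have "C ^ 3 > 0" using C by simp
  ultimately show ?thesis by blast
qed

theorem theorem3:
  fixes a \<delta> :: real
  assumes "0 < a" "a < 1" "0 < \<delta>" "\<delta> < 1"
  shows
    "(a \<in> \<rat> \<longrightarrow>
       (\<exists>C>0. \<exists>(P :: nat \<Rightarrow> (nat \<Rightarrow>\<^sub>0 real) set) (r :: nat \<Rightarrow> real) (R :: nat \<Rightarrow> real). \<forall>n\<ge>1.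
          polytope (P n) \<and> P n \<subseteq> Rn n \<and> affdim (P n) = int n \<and>
          0 < r n \<and> r n \<le> R n \<and>
          (*\<^sub>R) (r n) ` B2 n \<subseteq> P n \<and> P n \<subseteq> (*\<^sub>R) (R n) ` B2 n \<and>
          ln (real (card (facets (P n)))) \<le> C * real n powr (1 - a) \<and>
          ln (real (card (vertices (P n)))) \<le> C * real n powr (a + \<delta> * (1 - a)) \<and>
          (R n / r n)\<^sup>2 \<le> C * real n powr (1 - \<delta> + a) \<and>
          ln (real (card (vertices (P n)))) * ln (real (card (facets (P n)))) * (R n / r n)\<^sup>2
            \<le> C * real n powr (2 + a * (1 - \<delta>)))) \<and>
     (a \<notin> \<rat> \<longrightarrow>
       (\<exists>C>0. \<exists>(P :: nat \<Rightarrow> (nat \<Rightarrow>\<^sub>0 real) set) (r :: nat \<Rightarrow> real) (R :: nat \<Rightarrow> real)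
           (\<epsilon> :: nat \<Rightarrow> real).
          \<epsilon> \<longlonglongrightarrow> 0 \<and> (\<forall>n\<ge>2. \<bar>\<epsilon> n\<bar> \<le> C * (1 / sqrt (ln (real n)))) \<and>
          (\<forall>n\<ge>1.
             polytope (P n) \<and> P n \<subseteq> Rn n \<and> affdim (P n) = int n \<and>
             0 < r n \<and> r n \<le> R n \<and>
             (*\<^sub>R) (r n) ` B2 n \<subseteq> P n \<and> P n \<subseteq> (*\<^sub>R) (R n) ` B2 n \<and>
             ln (real (card (facets (P n)))) \<le> C * real n powr (1 - a) \<and>
             ln (real (card (vertices (P n)))) \<le> C * real n powr (a + \<delta> * (1 - a) + \<epsilon> n) \<and>
             (R n / r n)\<^sup>2 \<le> C * real n powr (1 - \<delta> + a) \<and>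
             ln (real (card (vertices (P n)))) * ln (real (card (facets (P n)))) * (R n / r n)\<^sup>2
               \<le> C * real n powr (2 + a * (1 - \<delta>) + \<epsilon> n))))"
proof -
  obtain C P r R where "C > 0" and P: "\<forall>n\<ge>1.
    polytope (P n) \<and> P n \<subseteq> Rn n \<and> affdim (P n) = int n \<and> 0 < r n \<and> r n \<le> R n \<and>
    (*\<^sub>R) (r n) ` B2 n \<subseteq> P n \<and> P n \<subseteq> (*\<^sub>R) (R n) ` B2 n \<and>
    ln (real (card (facets (P n)))) \<le> C * real n powr (1 - a) \<and>
    ln (real (card (vertices (P n)))) \<le> C * real n powr (a + \<delta> * (1 - a)) \<and>
    (R n / r n)\<^sup>2 \<le> C * real n powr (1 - \<delta> + a) \<and>
    ln (real (card (vertices (P n)))) * ln (real (card (facets (P n)))) * (R n / r n)\<^sup>2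
      \<le> C * real n powr (2 + a * (1 - \<delta>))"
    using exists_polytope_sequence[OF assms] by blast
  \<comment> \<open>The same sequence serves rational and irrational \<open>a\<close>; the zero
    error satisfies the rate because its bound is nonnegative.\<close>
  let ?\<epsilon> = "\<lambda>_. 0 :: real"
  have \<epsilon>: "?\<epsilon> \<longlonglongrightarrow> 0" "\<forall>n\<ge>2. \<bar>?\<epsilon> n\<bar> \<le> C * (1 / sqrt (ln (real n)))"
    using \<open>C > 0\<close> by simp_all
  show ?thesis
    by (rule conjI, rule impI, rule exists_polytope_sequence[OF assms], rule impI,
        rule exI[of _ C], rule conjI[OF \<open>C > 0\<close>], rule exI[of _ P], rule exI[of _ r],
        rule exI[of _ R], rule exI[of _ ?\<epsilon>], rule conjI[OF \<epsilon>(1)], rule conjI[OF \<epsilon>(2)])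
      (use P in simp)
qed

end
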